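(* Let $E$ be a locally complete lcHs over $\mathbb{K}$, let the linear subspace $G\subset E'$ determine boundedness and let $\mathcal{F}(\Omega)$ and $\mathcal{F}(\Omega,E)$ be $\varepsilon$-into-compatible. Let $(T^{E}_{m},T^{\mathbb{K}}_{m})_{m\in M}$ be a strong, consistent family for $(\mathcal{F},E)$, $\mathcal{F}(\Omega)$ a Fréchet–Schwartz space and $U$ a set of uniqueness for $(T^{\mathbb{K}}_{m},\mathcal{F})_{m\in M}$. Then the restriction map \[ R_{U,G}\colon S(\mathcal{F}(\Omega)\varepsilon E)\to\mathcal{F}_{G}(U,E),\; f\mapsto(T^{E}_{m}(f)(x))_{(m,x)\in U}, \] is surjective.
   Context: $\mathbb{K}=\mathbb{R}$ or $\mathbb{C}$. An lcHs is a non-trivial locally convex Hausdorff space over $\mathbb{K}$. For an lcHs $F$, $F'_{\kappa}$ is $F'$ with the topology of uniform convergence on absolutely convex compact subsets of $F$, and $F\varepsilon E:=L_{e}(F'_{\kappa},E)$ carries the topology of uniform convergence on equicontinuous subsets of $F'$. $\delta_x(f):=f(x)$. $E$ is locally complete if for every closed bounded absolutely convex $D\subset E$ the space $E_D:=\bigcup_n nD$, normed by the gauge of $D$, is a Banach space. A linear subspace $G\subset E'$ determines boundedness if every $\sigma(E,G)$-bounded set $B\subset E$ is bounded in $E$. $\mathcal{F}(\Omega)\subset\mathbb{K}^{\Omega}$ and $\mathcal{F}(\Omega,E)\subset E^{\Omega}$ are lcHs of functions on a non-empty set $\Omega$ with $\delta_x\in\mathcal{F}(\Omega)'$ for all $x\in\Omega$;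 they are $\varepsilon$-into-compatible if $S\colon\mathcal{F}(\Omega)\varepsilon E\to\mathcal{F}(\Omega,E)$, $u\mapsto[x\mapsto u(\delta_x)]$, is a well-defined topological isomorphism onto its range. Let $(\omega_m)_{m\in M}$ be non-empty sets and $T^{\mathbb{K}}_m\colon\operatorname{dom}T^{\mathbb{K}}_m\to\mathbb{K}^{\omega_m}$, $T^{E}_m\colon\operatorname{dom}T^{E}_m\to E^{\omega_m}$ linear with $\mathcal{F}(\Omega)\subset\operatorname{dom}T^{\mathbb{K}}_m\subset\mathbb{K}^{\Omega}$, $\mathcal{F}(\Omega,E)\subset\operatorname{dom}T^{E}_m\subset E^{\Omega}$. Put $T^{\mathbb{K}}_{m,x}:=\delta_x\circ T^{\mathbb{K}}_m$. The family $(T^{E}_m,T^{\mathbb{K}}_m)_{m\in M}$ is consistent for $(\mathcal{F},E)$ if for all $u\in\mathcal{F}(\Omega)\varepsilon E$, $m\in M$, $x\in\omega_m$: $S(u)\in\mathcal{F}(\Omega,E)$, $T^{\mathbb{K}}_{m,x}\in\mathcal{F}(\Omega)'$ and $T^{E}_m(S(u))(x)=u(T^{\mathbb{K}}_{m,x})$. It is strong if for all $e'\in E'$, $f\in\mathcal{F}(\Omega,E)$, $m\in M$, $x\in\omega_m$: $e'\circ f\in\mathcal{F}(\Omega)$ and $T^{\mathbb{K}}_m(e'\circ f)(x)=e'(T^{E}_m(f)(x))$. $U\subset\bigcup_{m\in M}(\{m\}\times\omega_m)$ is a set of uniqueness for $(T^{\mathbb{K}}_m,\mathcal{F})_{m\in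 M}$ if $T^{\mathbb{K}}_{m,x}\in\mathcal{F}(\Omega)'$ for all $(m,x)\in U$, and $f\in\mathcal{F}(\Omega)$ with $T^{\mathbb{K}}_m(f)(x)=0$ for all $(m,x)\in U$ implies $f=0$. $\mathcal{F}_{G}(U,E)$ is the space of functions $f\colon U\to E$ such that for every $e'\in G$ there is $f_{e'}\in\mathcal{F}(\Omega)$ with $T^{\mathbb{K}}_m(f_{e'})(x)=(e'\circ f)(m,x)$ for all $(m,x)\in U$. *)

theory Defs
  imports "HOL-Analysis.Analysis" "HOL-Library.Function_Algebras"
begin

section \<open>The scalar field\<close>

text \<open>The scalar field is the real or the complex field, up to isometric field isomorphism.\<close>

class real_or_complex = real_normed_field +
  assumes iso_real_or_complex:
    "(\<exists>\<phi>::'a \<Rightarrow> real. bij \<phi> \<and> (\<forall>x y. \<phi> (x + y) = \<phi> x + \<phi> y) \<and>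
        (\<forall>x y. \<phi> (x * y) = \<phi> x * \<phi> y) \<and> (\<forall>x. norm (\<phi> x) = norm x)) \<or>
     (\<exists>\<phi>::'a \<Rightarrow> complex. bij \<phi> \<and> (\<forall>x y. \<phi> (x + y) = \<phi> x + \<phi> y) \<and>
        (\<forall>x y. \<phi> (x * y) = \<phi> x * \<phi> y) \<and> (\<forall>x. norm (\<phi> x) = norm x))"

instance real :: real_or_complex
  by standard (rule disjI1, rule exI[of _ "\<lambda>x. x"], auto simp: bij_def)

instance complex :: real_or_complex
  by standard (rule disjI2, rule exI[of _ "\<lambda>x. x"], auto simp: bij_def)


section \<open>Locally convex Hausdorff spaces\<close>

text \<open>
  A space is given by a scalar multiplication on an ambient type and a topology whose
  underlying set is the carrier of the space, a linear subspace of the ambient type.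
  This lets spaces of functions carry topologies that need not be related to the
  topology of pointwise convergence.
\<close>

definition zero_nbhd :: "'v::zero topology \<Rightarrow> 'v set \<Rightarrow> bool" where
  "zero_nbhd T W \<longleftrightarrow> W \<subseteq> topspace T \<and> (\<exists>V. openin T V \<and> 0 \<in> V \<and> V \<subseteq> W)"

definition abs_convex ::
    "('k::real_or_complex \<Rightarrow> 'v::ab_group_add \<Rightarrow> 'v) \<Rightarrow> 'v set \<Rightarrow> bool" where
  "abs_convex s D \<longleftrightarrow>
     (\<forall>x\<in>D. \<forall>y\<in>D. \<forall>a b. norm a + norm b \<le> 1 \<longrightarrow> s a x + s b y \<in> D)"

locale lcHs = vector_space s
  for s :: "'k::real_or_complex \<Rightarrow> 'v::ab_group_add \<Rightarrow> 'v" +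
  fixes T :: "'v topology"
  assumes subspace_topspace: "subspace (topspace T)"
    and continuous_add: "continuous_map (prod_topology T T) T (\<lambda>(x, y). x + y)"
    and continuous_scale: "continuous_map (prod_topology euclidean T) T (\<lambda>(c, x). s c x)"
    and locally_convex:
      "\<And>W. zero_nbhd T W \<Longrightarrow> \<exists>C. abs_convex s C \<and> zero_nbhd T C \<and> C \<subseteq> W"
    and Hausdorff: "Hausdorff_space T"
    and nontrivial: "topspace T \<noteq> {0}"

definition vN_bounded ::
    "('k::real_or_complex \<Rightarrow> 'v::ab_group_add \<Rightarrow> 'v) \<Rightarrow> 'v topology \<Rightarrow> 'v set \<Rightarrow> bool" where
  "vN_bounded s T B \<longleftrightarrow>
     B \<subseteq> topspace T \<and> (\<forall>W. zero_nbhd T W \<longrightarrow> (\<exists>r>0. B \<subseteq> s (of_real r) ` W))"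

definition fun_scale :: "('k \<Rightarrow> 'v \<Rightarrow> 'v) \<Rightarrow> 'k \<Rightarrow> ('a \<Rightarrow> 'v) \<Rightarrow> ('a \<Rightarrow> 'v)" where
  "fun_scale s c f = (\<lambda>x. s c (f x))"


section \<open>Continuous linear maps and dual spaces\<close>

definition linear_map_on ::
    "('k \<Rightarrow> 'v \<Rightarrow> 'v) \<Rightarrow> ('k \<Rightarrow> 'w \<Rightarrow> 'w) \<Rightarrow> 'v set \<Rightarrow> ('v::ab_group_add \<Rightarrow> 'w::ab_group_add) \<Rightarrow> bool" where
  "linear_map_on s\<^sub>1 s\<^sub>2 V f \<longleftrightarrow>
     (\<forall>x\<in>V. \<forall>y\<in>V. f (x + y) = f x + f y) \<and> (\<forall>c. \<forall>x\<in>V. f (s\<^sub>1 c x) = s\<^sub>2 c (f x))"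

text \<open>
  A map defined on a subset of a type is represented by its extension by zero, so that
  spaces of linear maps are linear subspaces of the full function space.
\<close>

definition zero_ext :: "'v set \<Rightarrow> ('v \<Rightarrow> 'w::zero) \<Rightarrow> 'v \<Rightarrow> 'w" where
  "zero_ext V f = (\<lambda>v. if v \<in> V then f v else 0)"

definition cont_linear ::
    "('k \<Rightarrow> 'v \<Rightarrow> 'v) \<Rightarrow> 'v topology \<Rightarrow> ('k \<Rightarrow> 'w \<Rightarrow> 'w) \<Rightarrow> 'w topology
      \<Rightarrow> ('v::ab_group_add \<Rightarrow> 'w::ab_group_add) set" where
  "cont_linear s\<^sub>1 T\<^sub>1 s\<^sub>2 T\<^sub>2 =
     {u. linear_map_on s\<^sub>1 s\<^sub>2 (topspace T\<^sub>1) u \<and> continuous_map T\<^sub>1 T\<^sub>2 u \<and>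
         (\<forall>v. v \<notin> topspace T\<^sub>1 \<longrightarrow> u v = 0)}"

definition dual ::
    "('k::real_or_complex \<Rightarrow> 'v::ab_group_add \<Rightarrow> 'v) \<Rightarrow> 'v topology \<Rightarrow> ('v \<Rightarrow> 'k) set" where
  "dual s T = cont_linear s T (*) euclidean"

definition equicontinuous ::
    "('k::real_or_complex \<Rightarrow> 'v::ab_group_add \<Rightarrow> 'v) \<Rightarrow> 'v topology \<Rightarrow> ('v \<Rightarrow> 'k) set \<Rightarrow> bool" where
  "equicontinuous s T H \<longleftrightarrow> H \<subseteq> dual s T \<and>
     (\<forall>x\<in>topspace T. \<forall>\<epsilon>>0. \<exists>V. openin T V \<and> x \<in> V \<and>
        (\<forall>\<phi>\<in>H. \<forall>y\<in>V. norm (\<phi> y - \<phi> x) < \<epsilon>))"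

text \<open>
  The topology on \<open>L\<close> of uniform convergence on the members of \<open>\<SS>\<close>, for maps into a
  topological vector space with topology \<open>Y\<close>.
\<close>

definition unif_conv_topology ::
    "('x \<Rightarrow> 'y::ab_group_add) set \<Rightarrow> 'x set set \<Rightarrow> 'y topology \<Rightarrow> ('x \<Rightarrow> 'y) topology" where
  "unif_conv_topology L \<SS> Y = topology (\<lambda>W. W \<subseteq> L \<and>
     (\<forall>u\<in>W. \<exists>\<B> V. finite \<B> \<and> \<B> \<subseteq> \<SS> \<and> zero_nbhd Y V \<and>
        {v \<in> L. \<forall>x\<in>\<Union>\<B>. v x - u x \<in> V} \<subseteq> W))"

lemma zero_nbhd_Int:
  assumes "zero_nbhd T V" "zero_nbhd T W"
  shows "zero_nbhd T (V \<inter> W)"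
proof -
  obtain V' W' where "openin T V'" "0 \<in> V'" "V' \<subseteq> V" "openin T W'" "0 \<in> W'" "W' \<subseteq> W"
    using assms unfolding zero_nbhd_def by blast
  then have "openin T (V' \<inter> W') \<and> 0 \<in> V' \<inter> W' \<and> V' \<inter> W' \<subseteq> V \<inter> W"
    by blast
  moreover have "V \<inter> W \<subseteq> topspace T"
    using assms(1) unfolding zero_nbhd_def by blast
  ultimately show ?thesis
    unfolding zero_nbhd_def by blast
qed

lemma openin_unif_conv_topology:
  "openin (unif_conv_topology L \<SS> Y) W \<longleftrightarrow> W \<subseteq> L \<and>
     (\<forall>u\<in>W. \<exists>\<B> V. finite \<B> \<and> \<B> \<subseteq> \<SS> \<and> zero_nbhd Y V \<and>
        {v \<in> L. \<forall>x\<in>\<Union>\<B>. v x - u x \<in> V} \<subseteq> W)"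
proof -
  define P where "P W u \<longleftrightarrow> (\<exists>\<B> V. finite \<B> \<and> \<B> \<subseteq> \<SS> \<and> zero_nbhd Y V \<and>
        {v \<in> L. \<forall>x\<in>\<Union>\<B>. v x - u x \<in> V} \<subseteq> W)" for W u
  have P_Int: "P (W \<inter> W') u" if W: "P W u" and W': "P W' u" for W W' u
  proof -
    from W obtain \<B> V where 1: "finite \<B>" "\<B> \<subseteq> \<SS>" "zero_nbhd Y V"
      "{v \<in> L. \<forall>x\<in>\<Union>\<B>. v x - u x \<in> V} \<subseteq> W"
      unfolding P_def by blast
    from W' obtain \<B>' V' where 2: "finite \<B>'" "\<B>' \<subseteq> \<SS>" "zero_nbhd Y V'"
      "{v \<in> L. \<forall>x\<in>\<Union>\<B>'. v x - u x \<in> V'} \<subseteq> W'"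
      unfolding P_def by blast
    have "{v \<in> L. \<forall>x\<in>\<Union>(\<B> \<union> \<B>'). v x - u x \<in> V \<inter> V'} \<subseteq> W \<inter> W'"
    proof
      fix v assume "v \<in> {v \<in> L. \<forall>x\<in>\<Union>(\<B> \<union> \<B>'). v x - u x \<in> V \<inter> V'}"
      then have "v \<in> {v \<in> L. \<forall>x\<in>\<Union>\<B>. v x - u x \<in> V}"
        and "v \<in> {v \<in> L. \<forall>x\<in>\<Union>\<B>'. v x - u x \<in> V'}"
        by auto
      then show "v \<in> W \<inter> W'" using 1(4) 2(4) by (meson IntI subsetD)
    qed
    moreover have "finite (\<B> \<union> \<B>')" "\<B> \<union> \<B>' \<subseteq> \<SS>" "zero_nbhd Y (V \<inter> V')"
      using 1 2 zero_nbhd_Int[OF 1(3) 2(3)] by auto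
    ultimately show ?thesis unfolding P_def by (intro exI conjI)
  qed
  have P_mono: "P W' u" if "P W u" "W \<subseteq> W'" for W W' u
  proof -
    from that(1) obtain \<B> V where "finite \<B>" "\<B> \<subseteq> \<SS>" "zero_nbhd Y V"
      "{v \<in> L. \<forall>x\<in>\<Union>\<B>. v x - u x \<in> V} \<subseteq> W"
      unfolding P_def by blast
    then show ?thesis
      using that(2) unfolding P_def by (meson subset_trans)
  qed
  have "istopology (\<lambda>W. W \<subseteq> L \<and> (\<forall>u\<in>W. P W u))"
    unfolding istopology_def
  proof (intro conjI allI impI)
    fix S W
    assume "S \<subseteq> L \<and> (\<forall>u\<in>S. P S u)" "W \<subseteq> L \<and> (\<forall>u\<in>W. P W u)"
    then show "S \<inter> W \<subseteq> L" "\<forall>u\<in>S \<inter> W. P (S \<inter> W) u"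
      by (auto intro: P_Int)
  next
    fix \<K>
    assume "\<forall>K\<in>\<K>. K \<subseteq> L \<and> (\<forall>u\<in>K. P K u)"
    then show "\<Union>\<K> \<subseteq> L" "\<forall>u\<in>\<Union>\<K>. P (\<Union>\<K>) u"
      by (auto intro: P_mono[OF _ Union_upper])
  qed
  from fun_cong[OF topology_inverse'[OF this], of W] show ?thesis
    unfolding unif_conv_topology_def P_def .
qed

text \<open>The topology of uniform convergence on absolutely convex compact sets.\<close>

definition kappa_dual ::
    "('k::real_or_complex \<Rightarrow> 'v::ab_group_add \<Rightarrow> 'v) \<Rightarrow> 'v topology \<Rightarrow> ('v \<Rightarrow> 'k) topology" where
  "kappa_dual s T =
     unif_conv_topology (dual s T) {K. abs_convex s K \<and> compactin T K} euclidean"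

definition weak_topology :: "'v topology \<Rightarrow> ('v \<Rightarrow> 'k::topological_space) set \<Rightarrow> 'v topology" where
  "weak_topology T G = topology_generated_by {{x \<in> topspace T. \<phi> x \<in> W} | \<phi> W. \<phi> \<in> G \<and> open W}"


section \<open>Completeness and related properties of locally convex spaces\<close>

definition disk_span ::
    "('k::real_or_complex \<Rightarrow> 'v::ab_group_add \<Rightarrow> 'v) \<Rightarrow> 'v set \<Rightarrow> 'v set" where
  "disk_span s D = (\<Union>n::nat. s (of_nat n) ` D)"

definition gauge_of ::
    "('k::real_or_complex \<Rightarrow> 'v::ab_group_add \<Rightarrow> 'v) \<Rightarrow> 'v set \<Rightarrow> 'v \<Rightarrow> real" where
  "gauge_of s D x = Inf {t. 0 < t \<and> x \<in> s (of_real t) ` D}"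

text \<open>
  For a bounded absolutely convex set in a Hausdorff space the gauge is a norm on
  the span, so being a Banach space amounts to convergence of all Cauchy sequences.
\<close>

definition banach_disk ::
    "('k::real_or_complex \<Rightarrow> 'v::ab_group_add \<Rightarrow> 'v) \<Rightarrow> 'v set \<Rightarrow> bool" where
  "banach_disk s D \<longleftrightarrow>
     (\<forall>\<sigma>::nat \<Rightarrow> 'v. range \<sigma> \<subseteq> disk_span s D \<and>
        (\<forall>\<epsilon>>0. \<exists>N. \<forall>m\<ge>N. \<forall>n\<ge>N. gauge_of s D (\<sigma> m - \<sigma> n) < \<epsilon>) \<longrightarrow>
        (\<exists>l\<in>disk_span s D. (\<lambda>n. gauge_of s D (\<sigma> n - l)) \<longlonglongrightarrow> 0))"

definition locally_complete ::
    "('k::real_or_complex \<Rightarrow> 'v::ab_group_add \<Rightarrow> 'v) \<Rightarrow> 'v topology \<Rightarrow> bool" where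
  "locally_complete s T \<longleftrightarrow>
     (\<forall>D. closedin T D \<and> vN_bounded s T D \<and> abs_convex s D \<longrightarrow> banach_disk s D)"

definition determines_boundedness ::
    "('k::real_or_complex \<Rightarrow> 'v::ab_group_add \<Rightarrow> 'v) \<Rightarrow> 'v topology \<Rightarrow> ('v \<Rightarrow> 'k) set \<Rightarrow> bool" where
  "determines_boundedness s T G \<longleftrightarrow>
     (\<forall>B\<subseteq>topspace T. vN_bounded s (weak_topology T G) B \<longrightarrow> vN_bounded s T B)"

definition frechet ::
    "('k::real_or_complex \<Rightarrow> 'v::ab_group_add \<Rightarrow> 'v) \<Rightarrow> 'v topology \<Rightarrow> bool" where
  "frechet s T \<longleftrightarrow> lcHs s T \<and> metrizable_space T \<and>
     (\<forall>\<sigma>::nat \<Rightarrow> 'v. range \<sigma> \<subseteq> topspace T \<and>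
        (\<forall>W. zero_nbhd T W \<longrightarrow> (\<exists>N. \<forall>m\<ge>N. \<forall>n\<ge>N. \<sigma> m - \<sigma> n \<in> W)) \<longrightarrow>
        (\<exists>l. limitin T \<sigma> l sequentially))"

text \<open>
  Every zero neighbourhood \<open>W\<close> has a zero neighbourhood \<open>V\<close> that is precompact with respect
  to the gauge of \<open>W\<close>.
\<close>

definition schwartz ::
    "('k::real_or_complex \<Rightarrow> 'v::ab_group_add \<Rightarrow> 'v) \<Rightarrow> 'v topology \<Rightarrow> bool" where
  "schwartz s T \<longleftrightarrow> lcHs s T \<and>
     (\<forall>W. zero_nbhd T W \<and> abs_convex s W \<longrightarrow>
        (\<exists>V. zero_nbhd T V \<and>
           (\<forall>\<epsilon>>0. \<exists>A. finite A \<and> A \<subseteq> V \<and>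
              V \<subseteq> (\<Union>a\<in>A. (\<lambda>w. a + s (of_real \<epsilon>) w) ` W))))"


section \<open>The epsilon product and spaces of functions\<close>

definition eps_product ::
    "('k::real_or_complex \<Rightarrow> 'f::ab_group_add \<Rightarrow> 'f) \<Rightarrow> 'f topology \<Rightarrow>
     ('k \<Rightarrow> 'e::ab_group_add \<Rightarrow> 'e) \<Rightarrow> 'e topology \<Rightarrow> (('f \<Rightarrow> 'k) \<Rightarrow> 'e) topology" where
  "eps_product sF F sE E =
     unif_conv_topology (cont_linear (fun_scale (*)) (kappa_dual sF F) sE E)
       {H. equicontinuous sF F H} E"

text \<open>
  In the following, \<open>F\<close> and \<open>FE\<close> are the topologies of spaces of scalar-valued and
  \<open>E\<close>-valued functions on the set of all elements of the type \<open>'w\<close>.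
\<close>

definition delta :: "('w \<Rightarrow> 'k::real_or_complex) topology \<Rightarrow> 'w \<Rightarrow> ('w \<Rightarrow> 'k) \<Rightarrow> 'k" where
  "delta F x = zero_ext (topspace F) (\<lambda>f. f x)"

definition eps_map ::
    "('w \<Rightarrow> 'k::real_or_complex) topology \<Rightarrow> ((('w \<Rightarrow> 'k) \<Rightarrow> 'k) \<Rightarrow> 'e) \<Rightarrow> 'w \<Rightarrow> 'e" where
  "eps_map F u = (\<lambda>x. u (delta F x))"

text \<open>Linearity of \<open>eps_map F\<close> holds by definition.\<close>

definition eps_into_compatible ::
    "('w \<Rightarrow> 'k::real_or_complex) topology \<Rightarrow> ('k \<Rightarrow> 'e::ab_group_add \<Rightarrow> 'e) \<Rightarrow> 'e topology \<Rightarrow>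
     ('w \<Rightarrow> 'e) topology \<Rightarrow> bool" where
  "eps_into_compatible F sE E FE \<longleftrightarrow>
     eps_map F ` topspace (eps_product (fun_scale (*)) F sE E) \<subseteq> topspace FE \<and>
     embedding_map (eps_product (fun_scale (*)) F sE E) FE (eps_map F)"


section \<open>Families of operators\<close>

text \<open>The functional \<open>f \<mapsto> TK m f x\<close> on the space with topology \<open>F\<close>.\<close>

definition op_eval ::
    "('w \<Rightarrow> 'k::real_or_complex) topology \<Rightarrow> ('m \<Rightarrow> ('w \<Rightarrow> 'k) \<Rightarrow> 'i \<Rightarrow> 'k) \<Rightarrow> 'm \<Rightarrow> 'i
      \<Rightarrow> ('w \<Rightarrow> 'k) \<Rightarrow> 'k" where
  "op_eval F TK m x = zero_ext (topspace F) (\<lambda>f. TK m f x)"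

text \<open>
  Each \<open>Op m\<close> is a linear map from the subspace \<open>Dm m\<close> of the \<open>E\<close>-valued functions on \<open>'w\<close>
  to the \<open>E\<close>-valued functions on \<open>\<omega> m\<close>; its values off \<open>Dm m\<close> and off \<open>\<omega> m\<close> are irrelevant.
\<close>

definition operator_family ::
    "('k::real_or_complex \<Rightarrow> 'e::ab_group_add \<Rightarrow> 'e) \<Rightarrow> 'e topology \<Rightarrow> ('w \<Rightarrow> 'e) topology \<Rightarrow>
     'm set \<Rightarrow> ('m \<Rightarrow> 'i set) \<Rightarrow> ('m \<Rightarrow> ('w \<Rightarrow> 'e) set) \<Rightarrow> ('m \<Rightarrow> ('w \<Rightarrow> 'e) \<Rightarrow> 'i \<Rightarrow> 'e) \<Rightarrow> bool" where
  "operator_family sE E FE M \<omega> Dm Op \<longleftrightarrow>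
     (\<forall>m\<in>M. topspace FE \<subseteq> Dm m \<and> Dm m \<subseteq> {f. range f \<subseteq> topspace E} \<and>
        module.subspace (fun_scale sE) (Dm m) \<and>
        (\<forall>x\<in>\<omega> m. (\<forall>f\<in>Dm m. Op m f x \<in> topspace E) \<and>
                   linear_map_on (fun_scale sE) sE (Dm m) (\<lambda>f. Op m f x)))"

definition consistent_family ::
    "('w \<Rightarrow> 'k::real_or_complex) topology \<Rightarrow> ('k \<Rightarrow> 'e::ab_group_add \<Rightarrow> 'e) \<Rightarrow> 'e topology \<Rightarrow>
     ('w \<Rightarrow> 'e) topology \<Rightarrow> 'm set \<Rightarrow> ('m \<Rightarrow> 'i set) \<Rightarrow>
     ('m \<Rightarrow> ('w \<Rightarrow> 'e) \<Rightarrow> 'i \<Rightarrow> 'e) \<Rightarrow> ('m \<Rightarrow> ('w \<Rightarrow> 'k) \<Rightarrow> 'i \<Rightarrow> 'k) \<Rightarrow> bool" where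
  "consistent_family F sE E FE M \<omega> TE TK \<longleftrightarrow>
     (\<forall>u\<in>topspace (eps_product (fun_scale (*)) F sE E). \<forall>m\<in>M. \<forall>x\<in>\<omega> m.
        eps_map F u \<in> topspace FE \<and> op_eval F TK m x \<in> dual (fun_scale (*)) F \<and>
        TE m (eps_map F u) x = u (op_eval F TK m x))"

definition strong_family ::
    "('w \<Rightarrow> 'k::real_or_complex) topology \<Rightarrow> ('k \<Rightarrow> 'e::ab_group_add \<Rightarrow> 'e) \<Rightarrow> 'e topology \<Rightarrow>
     ('w \<Rightarrow> 'e) topology \<Rightarrow> 'm set \<Rightarrow> ('m \<Rightarrow> 'i set) \<Rightarrow>
     ('m \<Rightarrow> ('w \<Rightarrow> 'e) \<Rightarrow> 'i \<Rightarrow> 'e) \<Rightarrow> ('m \<Rightarrow> ('w \<Rightarrow> 'k) \<Rightarrow> 'i \<Rightarrow> 'k) \<Rightarrow> bool" where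
  "strong_family F sE E FE M \<omega> TE TK \<longleftrightarrow>
     (\<forall>e'\<in>dual sE E. \<forall>f\<in>topspace FE. \<forall>m\<in>M. \<forall>x\<in>\<omega> m.
        e' \<circ> f \<in> topspace F \<and> TK m (e' \<circ> f) x = e' (TE m f x))"

definition set_of_uniqueness ::
    "('w \<Rightarrow> 'k::real_or_complex) topology \<Rightarrow> 'm set \<Rightarrow> ('m \<Rightarrow> 'i set) \<Rightarrow>
     ('m \<Rightarrow> ('w \<Rightarrow> 'k) \<Rightarrow> 'i \<Rightarrow> 'k) \<Rightarrow> ('m \<times> 'i) set \<Rightarrow> bool" where
  "set_of_uniqueness F M \<omega> TK U \<longleftrightarrow>
     U \<subseteq> Sigma M \<omega> \<and>
     (\<forall>(m, x)\<in>U. op_eval F TK m x \<in> dual (fun_scale (*)) F) \<and>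
     (\<forall>f\<in>topspace F. (\<forall>(m, x)\<in>U. TK m f x = 0) \<longrightarrow> f = 0)"

definition restriction_space ::
    "('w \<Rightarrow> 'k::real_or_complex) topology \<Rightarrow> 'e topology \<Rightarrow> ('m \<Rightarrow> ('w \<Rightarrow> 'k) \<Rightarrow> 'i \<Rightarrow> 'k) \<Rightarrow>
     ('e \<Rightarrow> 'k) set \<Rightarrow> ('m \<times> 'i) set \<Rightarrow> ('m \<times> 'i \<Rightarrow> 'e) set" where
  "restriction_space F E TK G U =
     {f \<in> U \<rightarrow>\<^sub>E topspace E. \<forall>e'\<in>G. \<exists>g\<in>topspace F. \<forall>(m, x)\<in>U. TK m g x = (e' \<circ> f) (m, x)}"

definition restriction_map ::
    "('m \<Rightarrow> ('w \<Rightarrow> 'e) \<Rightarrow> 'i \<Rightarrow> 'e) \<Rightarrow> ('m \<times> 'i) set \<Rightarrow> ('w \<Rightarrow> 'e) \<Rightarrow> 'm \<times> 'i \<Rightarrow> 'e" where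
  "restriction_map TE U f = (\<lambda>(m, x)\<in>U. TE m f x)"

end

theory Submission
  imports Defs "HOL-Library.Diagonal_Subsequence"
begin

text \<open>
  For \<open>e' \<in> G\<close> let \<open>g e' \<in> F\<close> be the function with \<open>TK m (g e') x = e' (f (m, x))\<close> on \<open>U\<close>, and let
  \<open>Y\<close> be the space of all \<open>y \<in> F'\<close> for which some \<open>u y \<in> E\<close> satisfies \<open>e' (u y) = y (g e')\<close> for all
  \<open>e' \<in> G\<close>. It contains the functionals \<open>op_eval F TK m x\<close> with \<open>(m, x) \<in> U\<close>, so \<open>Y\<close> separates the
  points of \<open>F\<close>, and what has to be shown is that \<open>Y = F'\<close> and that \<open>u\<close> is continuous on \<open>F'\<^sub>\<kappa>\<close>.

  Since \<open>G\<close> determines boundedness, \<open>u\<close> maps equicontinuous sets into closed disks that are defined by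
  bounds on the members of \<open>G\<close>, and these are Banach disks. By the Schwartz property a point in the weak*
  closure of a part of a polar \<open>W\<degree>\<close> is the limit of a sequence in that part uniformly on a smaller
  neighbourhood \<open>V\<close>; the images of such a sequence in \<open>Y\<close> are Cauchy in a Banach disk. Therefore
  \<open>Y \<inter> W\<degree>\<close> is weak* closed, and \<open>u\<close> is weak* continuous on each \<open>W\<degree>\<close>. The Banach-Dieudonne theorem
  (a set that misses \<open>0\<close> and meets every \<open>W\<degree>\<close> in a weak* closed set is disjoint from the polar of an
  absolutely convex compact set) then gives both claims: applied to \<open>y\<^sub>0 - Y\<close> with \<open>y\<^sub>0 \<in> F' - Y\<close> and
  combined with finite-dimensional separation it yields a nonzero point of \<open>F\<close> at which \<open>Y\<close>
  vanishes, and applied to the complement of \<open>u\<^sup>-\<^sup>1(N)\<close> it yields the continuity of \<open>u\<close>.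
\<close>

section \<open>Scalars\<close>

text \<open>The class only provides an isometric isomorphism onto the real or the complex numbers.
  Embedding both cases into \<open>complex\<close> gives access to real parts and conjugates; the
  range is stable under conjugation in either case.\<close>

lemma scalar_embedding:
  obtains \<phi> :: "'k::real_or_complex \<Rightarrow> complex" where
    "\<And>x y. \<phi> (x + y) = \<phi> x + \<phi> y" "\<And>x y. \<phi> (x * y) = \<phi> x * \<phi> y"
    "\<And>x. norm (\<phi> x) = norm x" "\<And>x. \<exists>z. \<phi> z = cnj (\<phi> x)" "\<And>r. \<phi> (of_real r) = of_real r"
    "closed (range \<phi>)"
proof -
  have "\<exists>\<phi> :: 'k \<Rightarrow> complex. (\<forall>x y. \<phi> (x + y) = \<phi> x + \<phi> y) \<and> (\<forall>x y. \<phi> (x * y) = \<phi> x * \<phi> y) \<and>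
      (\<forall>x. norm (\<phi> x) = norm x) \<and> (\<forall>x. \<exists>z. \<phi> z = cnj (\<phi> x)) \<and> closed (range \<phi>)"
    using iso_real_or_complex
  proof (elim disjE exE conjE)
    fix \<phi> :: "'k \<Rightarrow> real"
    assume \<phi>: "bij \<phi>" "\<forall>x y. \<phi> (x + y) = \<phi> x + \<phi> y" "\<forall>x y. \<phi> (x * y) = \<phi> x * \<phi> y"
      "\<forall>x. norm (\<phi> x) = norm x"
    have "range (\<lambda>x. complex_of_real (\<phi> x)) = \<real>"
      using bij_is_surj[OF \<phi>(1)] unfolding Reals_def by (metis image_image)
    then have "closed (range (\<lambda>x. complex_of_real (\<phi> x)))"
      by (simp add: closed_complex_Reals)
    with \<phi> show ?thesis
      by (intro exI[of _ "\<lambda>x. complex_of_real (\<phi> x)"]) auto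
  next
    fix \<phi> :: "'k \<Rightarrow> complex"
    assume \<phi>: "bij \<phi>" "\<forall>x y. \<phi> (x + y) = \<phi> x + \<phi> y" "\<forall>x y. \<phi> (x * y) = \<phi> x * \<phi> y"
      "\<forall>x. norm (\<phi> x) = norm x"
    have "\<exists>z. \<phi> z = w" for w
      using bij_is_surj[OF \<phi>(1)] by (metis surjD)
    then show ?thesis
      using \<phi> bij_is_surj[OF \<phi>(1)] by (intro exI[of _ \<phi>]) auto
  qed
  then obtain \<phi> :: "'k \<Rightarrow> complex" where add: "\<And>x y. \<phi> (x + y) = \<phi> x + \<phi> y"
    and mult: "\<And>x y. \<phi> (x * y) = \<phi> x * \<phi> y" and norm: "\<And>x. norm (\<phi> x) = norm x"
    and cnj: "\<And>x. \<exists>z. \<phi> z = cnj (\<phi> x)" and closed: "closed (range \<phi>)"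
    by blast
  have one: "\<phi> 1 = 1"
    using mult[of 1 1] norm[of 1] by auto
  have "\<phi> 0 = 0"
    using norm[of 0] by simp
  then have minus: "\<phi> (- x) = - \<phi> x" for x
    using add[of x "- x"] by (simp add: eq_neg_iff_add_eq_0 add.commute)
  \<comment> \<open>Real linearity is not given. The image of \<open>r\<close> is pinned down by its
    distances to \<open>0\<close>, \<open>1\<close> and \<open>-1\<close>, which
    \<open>\<phi>\<close> preserves.\<close>
  have "\<phi> (of_real r) = of_real r" for r
  proof -
    let ?z = "\<phi> (of_real r)"
    have 0: "(norm ?z)\<^sup>2 = r\<^sup>2"
      by (simp add: norm)
    have "norm (?z + 1) = norm (of_real r + 1 :: 'k)" "norm (?z - 1) = norm (of_real r - 1 :: 'k)"
      using add[of "of_real r" 1] add[of "of_real r" "- 1"] one minus[of 1] norm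
      by (metis, metis add_uminus_conv_diff)
    then have "norm (?z + 1) = \<bar>r + 1\<bar>" "norm (?z - 1) = \<bar>r - 1\<bar>"
      by (metis norm_of_real of_real_1 of_real_add, metis norm_of_real of_real_1 of_real_diff)
    then have "(norm (?z + 1))\<^sup>2 = (r + 1)\<^sup>2" "(norm (?z - 1))\<^sup>2 = (r - 1)\<^sup>2"
      by simp_all
    then have "Re ?z = r"
      unfolding cmod_power2 by (simp add: power2_eq_square algebra_simps)
    then show ?thesis
      using 0 unfolding cmod_power2 by (simp add: complex_eq_iff)
  qed
  then show thesis
    using that add mult norm cnj closed by blast
qed

text \<open>\<open>\<phi>\<close> is an isometry with closed range, so the ball corresponds to a
  closed bounded set of complex numbers. This feeds Tychonoff's theorem in
  \<open>compact_polar\<close>.\<close>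

lemma compact_cball_scalar: "compact (cball 0 r :: 'k::real_or_complex set)"
proof -
  obtain \<phi> :: "'k \<Rightarrow> complex" where \<phi>:
    "\<And>x y. \<phi> (x + y) = \<phi> x + \<phi> y" "\<And>x y. \<phi> (x * y) = \<phi> x * \<phi> y" "\<And>x. norm (\<phi> x) = norm x"
    "\<And>r. \<phi> (of_real r) = of_real r" "closed (range \<phi>)"
    using scalar_embedding by metis
  have diff: "dist (\<phi> x) (\<phi> y) = dist x y" for x y
    using \<phi>(1)[of "x - y" y] \<phi>(3)[of "x - y"] by (simp add: dist_norm)
  have inj: "inj \<phi>"
    by (rule injI) (metis diff dist_eq_0_iff)
  have "continuous_on (range \<phi>) (inv \<phi>)"
    unfolding continuous_on_iff using diff inj by (auto simp: inv_f_f)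
  moreover have "cball 0 r = inv \<phi> ` \<phi> ` cball 0 r"
    using inj by simp
  moreover have "\<phi> ` cball 0 r = range \<phi> \<inter> cball 0 r"
    using \<phi>(3) by auto
  moreover have "compact (range \<phi> \<inter> cball 0 r)"
    using \<phi>(5) by (simp add: closed_Int_compact)
  ultimately show ?thesis
    by (metis compact_continuous_image continuous_on_subset inf_le1)
qed

text \<open>The right derivative at a minimum is nonnegative: dividing by \<open>t\<close> and
  letting \<open>t\<close> tend to \<open>0\<close> leaves \<open>2 * a\<close>. It supplies the
  first-order condition in \<open>finite_interpolation\<close>.\<close>

lemma quadratic_nonneg_slope:
  fixes a b :: real
  assumes "\<And>t. 0 < t \<Longrightarrow> t \<le> 1 \<Longrightarrow> 0 \<le> 2 * t * a + t\<^sup>2 * b" "b \<ge> 0"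
  shows "a \<ge> 0"
proof (rule ccontr)
  assume a: "\<not> a \<ge> 0"
  \<comment> \<open>The summand \<open>1\<close> keeps the denominator positive when
    \<open>b = 0\<close>; the choice forces \<open>t * b \<le> - a\<close>, hence
    \<open>2 * a + t * b < 0\<close>.\<close>
  define t where "t = min 1 (- a / (b + 1))"
  have "- a / (b + 1) > 0"
    using a assms(2) by (intro divide_pos_pos) auto
  then have t: "0 < t" "t \<le> 1" "t \<le> - a / (b + 1)"
    by (simp_all add: t_def)
  then have "t * (b + 1) \<le> - a"
    using assms(2) by (subst (asm) pos_le_divide_eq) auto
  have "t * b \<le> - a"
    using t(1) \<open>t * (b + 1) \<le> - a\<close> by (simp add: algebra_simps)
  then have "2 * a + t * b < 0"
    using a by linarith
  then have "t * (2 * a + t * b) < 0"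
    using t(1) by (simp add: mult_pos_neg)
  then show False
    using assms(1)[OF t(1,2)] by (simp add: power2_eq_square algebra_simps)
qed

section \<open>Zero neighbourhoods\<close>

lemma abs_convexD:
  "abs_convex s D \<Longrightarrow> x \<in> D \<Longrightarrow> y \<in> D \<Longrightarrow> norm a + norm b \<le> 1 \<Longrightarrow> s a x + s b y \<in> D"
  unfolding abs_convex_def by blast

lemma zero_nbhd_mono: "zero_nbhd T V \<Longrightarrow> V \<subseteq> W \<Longrightarrow> W \<subseteq> topspace T \<Longrightarrow> zero_nbhd T W"
  unfolding zero_nbhd_def by blast

lemma zero_nbhd_openin: "openin T V \<Longrightarrow> 0 \<in> V \<Longrightarrow> zero_nbhd T V"
  unfolding zero_nbhd_def using openin_subset by blast

lemma abs_convex_Int: "abs_convex s A \<Longrightarrow> abs_convex s B \<Longrightarrow> abs_convex s (A \<inter> B)"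
  unfolding abs_convex_def by blast

lemma abs_convex_INT: "(\<And>i. i \<in> I \<Longrightarrow> abs_convex s (A i)) \<Longrightarrow> abs_convex s (\<Inter>i\<in>I. A i)"
  unfolding abs_convex_def by (simp add: INT_iff)

lemma linear_map_onD:
  assumes "linear_map_on s\<^sub>1 s\<^sub>2 V f"
  shows "x \<in> V \<Longrightarrow> y \<in> V \<Longrightarrow> f (x + y) = f x + f y" "x \<in> V \<Longrightarrow> f (s\<^sub>1 c x) = s\<^sub>2 c (f x)"
  using assms unfolding linear_map_on_def by blast+

text \<open>Members vanish off the carrier, so the product topology of the full function space
  induces the weak* topology here; \<open>closed\<close>, \<open>closure\<close> and
  \<open>compact\<close> below refer to it.\<close>

definition polar :: "('k::real_or_complex \<Rightarrow> 'v::ab_group_add \<Rightarrow> 'v) \<Rightarrow> 'v topology \<Rightarrow> 'v set \<Rightarrow> ('v \<Rightarrow> 'k) set"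
  where "polar s T W = {y \<in> dual s T. \<forall>x\<in>W. norm (y x) \<le> 1}"

context lcHs
begin

lemma topspace_closed: 
  "0 \<in> topspace T" "x \<in> topspace T \<Longrightarrow> y \<in> topspace T \<Longrightarrow> x + y \<in> topspace T"
  "x \<in> topspace T \<Longrightarrow> s c x \<in> topspace T"
  "x \<in> topspace T \<Longrightarrow> y \<in> topspace T \<Longrightarrow> x - y \<in> topspace T"
  using subspace_topspace subspace_0 subspace_add subspace_scale subspace_diff by blast+

lemma continuous_map_plus:
  assumes "continuous_map X T f" "continuous_map X T g"
  shows "continuous_map X T (\<lambda>x. f x + g x)"
  using continuous_map_compose[OF continuous_map_pairedI[OF assms] continuous_add]
  by (simp add: o_def)

lemma continuous_map_scale:
  assumes "continuous_map X euclidean c" "continuous_map X T g"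
  shows "continuous_map X T (\<lambda>x. s (c x) (g x))"
  using continuous_map_compose[OF continuous_map_pairedI[OF assms] continuous_scale]
  by (simp add: o_def)

lemma continuous_map_scale_const:
  "continuous_map X T g \<Longrightarrow> continuous_map X T (\<lambda>x. s c (g x))"
  by (rule continuous_map_scale) auto

lemma continuous_map_minus:
  assumes "continuous_map X T f" "continuous_map X T g"
  shows "continuous_map X T (\<lambda>x. f x - g x)"
  using continuous_map_plus[OF assms(1) continuous_map_scale_const[OF assms(2), of "- 1"]]
  by simp

lemma zero_nbhd_topspace: "zero_nbhd T (topspace T)"
  using topspace_closed(1) by (intro zero_nbhd_openin) auto

lemma abs_convex_topspace: "abs_convex s (topspace T)"
  unfolding abs_convex_def using topspace_closed by blast

lemma abs_convex_balanced:
  assumes "abs_convex s W" "x \<in> W" "norm c \<le> 1"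
  shows "s c x \<in> W"
  using abs_convexD[OF assms(1,2,2), of c 0] assms(3) by simp

lemma scale_cancel: "c \<noteq> 0 \<Longrightarrow> s c (s (inverse c) x) = x" "c \<noteq> 0 \<Longrightarrow> s (inverse c) (s c x) = x"
  by simp_all

lemma in_scaled_iff:
  "c \<noteq> 0 \<Longrightarrow> x \<in> s c ` W \<longleftrightarrow> s (inverse c) x \<in> W"
  by (metis image_iff scale_cancel)

lemma abs_convex_scaled_mono:
  assumes W: "abs_convex s W" and r: "0 < r" "r \<le> r'" and x: "x \<in> s (of_real r) ` W"
  shows "x \<in> s (of_real r') ` W"
proof -
  have "s (of_real (r / r')) (s (inverse (of_real r)) x) \<in> W"
    using W
  proof (rule abs_convex_balanced)
    show "s (inverse (of_real r)) x \<in> W"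
      using r x in_scaled_iff[of "of_real r"] by simp
    show "norm (of_real (r / r') :: 'k) \<le> 1"
      using r unfolding norm_of_real by simp
  qed
  moreover have "s (of_real (r / r')) (s (inverse (of_real r)) x) = s (inverse (of_real r')) x"
    using r by (simp add: field_simps)
  ultimately show ?thesis
    using r by (subst in_scaled_iff) auto
qed

lemma zero_nbhd_scaled:
  assumes W: "zero_nbhd T W" and c: "c \<noteq> 0"
  shows "zero_nbhd T (s c ` W)"
proof -
  obtain V where V: "openin T V" "0 \<in> V" "V \<subseteq> W" and WT: "W \<subseteq> topspace T"
    using W unfolding zero_nbhd_def by blast
  have "openin T {x \<in> topspace T. s (inverse c) x \<in> V}"
    by (rule openin_continuous_map_preimage[OF _ V(1)]) (rule continuous_map_scale_const, simp)
  then have "zero_nbhd T {x \<in> topspace T. s (inverse c) x \<in> V}"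
    by (rule zero_nbhd_openin) (use V topspace_closed in auto)
  then show ?thesis
    by (rule zero_nbhd_mono) (use V WT c in_scaled_iff[OF c] topspace_closed(3) in auto)
qed

lemma abs_convex_scaled:
  assumes W: "abs_convex s W"
  shows "abs_convex s (s c ` W)"
  unfolding abs_convex_def
proof (intro ballI allI impI)
  fix x y and a b ::'k
  assume "x \<in> s c ` W" "y \<in> s c ` W" and ab: "norm a + norm b \<le> 1"
  then obtain x' y' where x': "x' \<in> W" "x = s c x'" and y': "y' \<in> W" "y = s c y'"
    by blast
  have "s a x + s b y = s c (s a x' + s b y')"
    by (simp add: x' y' scale_right_distrib mult.commute)
  moreover have "s a x' + s b y' \<in> W"
    using W x'(1) y'(1) ab by (rule abs_convexD)
  ultimately show "s a x + s b y \<in> s c ` W"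
    by blast
qed

lemma zero_nbhd_absorbing:
  assumes W: "zero_nbhd T W" and x: "x \<in> topspace T"
  obtains r where "r > 0" "\<And>r'. r \<le> r' \<Longrightarrow> x \<in> s (of_real r') ` W"
proof -
  obtain V where V: "openin T V" "0 \<in> V" "V \<subseteq> W"
    using W unfolding zero_nbhd_def by blast
  have "continuous_map euclidean T (\<lambda>c. s c x)"
    by (rule continuous_map_scale) (use x in auto)
  then have "open {c. s c x \<in> V}"
    using openin_continuous_map_preimage[OF _ V(1)] by fastforce
  then obtain \<delta> where \<delta>: "\<delta> > 0" "\<And>c. norm c < \<delta> \<Longrightarrow> s c x \<in> V"
    using V(2) unfolding open_dist by (auto simp: dist_norm dest: spec[of _ 0])
  show thesis
  proof
    \<comment> \<open>Not \<open>1 / \<delta>\<close>, since the inverse of the factor has to stay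
      strictly below \<open>\<delta>\<close>.\<close>
    show "2 / \<delta> > 0"
      using \<delta> by simp
  next
    fix r' assume r': "2 / \<delta> \<le> r'"
    then have "r' > 0"
      using \<delta>(1) by (meson divide_pos_pos less_le_trans zero_less_numeral)
    moreover have "inverse r' < \<delta>"
    proof -
      have "2 \<le> r' * \<delta>" using r' \<delta>(1) by (simp add: field_simps)
      then show ?thesis using \<open>r' > 0\<close> by (simp add: field_simps)
    qed
    ultimately show "x \<in> s (of_real r') ` W"
      using \<delta>(2)[of "inverse (of_real r')"] V(3) by (subst in_scaled_iff) (auto simp: norm_inverse)
  qed
qed

lemma zero_nbhd_absorbing_finite:
  assumes W: "zero_nbhd T W" "abs_convex s W" and "finite A" "A \<subseteq> topspace T"
  obtains r where "r \<ge> (1::real)" "A \<subseteq> s (of_real r) ` W"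
proof -
  have "\<exists>r\<ge>1::real. A \<subseteq> s (of_real r) ` W"
    using assms(3,4)
  proof (induction A)
    case (insert x A)
    then obtain r where r: "r \<ge> 1" "A \<subseteq> s (of_real r) ` W"
      by auto
    obtain r' where r': "r' > 0" "\<And>r''. r' \<le> r'' \<Longrightarrow> x \<in> s (of_real r'') ` W"
      using zero_nbhd_absorbing[OF W(1)] insert.prems by blast
    have "A \<subseteq> s (of_real (max r r')) ` W"
      using r abs_convex_scaled_mono[OF W(2), of r "max r r'"] by auto
    then show ?case
      using r r'(2)[of "max r r'"] by (intro exI[of _ "max r r'"]) auto
  qed (auto intro: exI[of _ 1])
  then show thesis
    using that by blast
qed

lemma openin_translate:
  assumes "openin T N" "x \<in> N"
  obtains W where "zero_nbhd T W" "\<And>w. w \<in> W \<Longrightarrow> x + w \<in> N"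
proof
  have "openin T {w \<in> topspace T. x + w \<in> N}"
    by (rule openin_continuous_map_preimage[OF _ assms(1)])
      (use subsetD[OF openin_subset[OF assms(1)] assms(2)] in \<open>auto intro!: continuous_map_plus\<close>)
  then show "zero_nbhd T {w \<in> topspace T. x + w \<in> N}"
    by (rule zero_nbhd_openin) (use assms topspace_closed in auto)
qed auto

lemma zero_nbhd_separates:
  assumes "x \<in> topspace T" "x \<noteq> 0"
  obtains W where "zero_nbhd T W" "x \<notin> W"
proof -
  obtain U V where "openin T U" "openin T V" "0 \<in> U" "x \<in> V" "disjnt U V"
    using Hausdorff assms topspace_closed(1) unfolding Hausdorff_space_def by metis
  then show thesis
    using that zero_nbhd_openin[of T U] by (auto simp: disjnt_def)
qed

section \<open>Polars in the dual\<close>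

lemma dualD:
  assumes "y \<in> dual s T"
  shows "x \<in> topspace T \<Longrightarrow> z \<in> topspace T \<Longrightarrow> y (x + z) = y x + y z"
    "x \<in> topspace T \<Longrightarrow> y (s c x) = c * y x"
    "continuous_map T euclidean y"
    "x \<notin> topspace T \<Longrightarrow> y x = 0"
    "y 0 = 0"
    "x \<in> topspace T \<Longrightarrow> z \<in> topspace T \<Longrightarrow> y (x - z) = y x - y z"
proof -
  show add: "x \<in> topspace T \<Longrightarrow> z \<in> topspace T \<Longrightarrow> y (x + z) = y x + y z"
    and scale: "x \<in> topspace T \<Longrightarrow> y (s c x) = c * y x"
    and "continuous_map T euclidean y" "x \<notin> topspace T \<Longrightarrow> y x = 0" for x z c
    using assms unfolding dual_def cont_linear_def linear_map_on_def by auto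
  show "y 0 = 0"
    using scale[of 0 0] topspace_closed(1) by simp
  show "x \<in> topspace T \<Longrightarrow> z \<in> topspace T \<Longrightarrow> y (x - z) = y x - y z"
    using add[of "x - z" z] topspace_closed by (simp add: algebra_simps)
qed

text \<open>Linearity carries the bound on \<open>W\<close> to every point \<open>x\<close>: if
  \<open>z - x\<close> lies in a small multiple of \<open>W\<close>, then \<open>y z\<close> is
  close to \<open>y x\<close>.\<close>

lemma dualI:
  assumes W: "zero_nbhd T W" and y: "linear_map_on s (*) (topspace T) y"
    "\<And>x. x \<notin> topspace T \<Longrightarrow> y x = 0" "\<And>x. x \<in> W \<Longrightarrow> norm (y x) \<le> 1"
  shows "y \<in> dual s T"
proof -
  note lin = linear_map_onD[OF y(1)]
  obtain V where V: "openin T V" "0 \<in> V" "V \<subseteq> W"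
    using W unfolding zero_nbhd_def by blast
  have "openin T {x \<in> topspace T. y x \<in> N}" if N: "open N" for N
  proof (subst openin_subopen, safe)
    fix x assume x: "x \<in> topspace T" "y x \<in> N"
    then obtain \<delta> where \<delta>: "\<delta> > 0" "\<And>z. dist z (y x) < \<delta> \<Longrightarrow> z \<in> N"
      using N unfolding open_dist by auto
    let ?c = "of_real (\<delta> / 2) ::'k"
    have c: "?c \<noteq> 0" "norm ?c < \<delta>"
      using \<delta>(1) by auto
    let ?V = "{z \<in> topspace T. s (inverse ?c) (z - x) \<in> V}"
    have "openin T ?V"
      by (rule openin_continuous_map_preimage[OF _ V(1)])
        (use x in \<open>auto intro!: continuous_map_scale_const continuous_map_minus\<close>)
    moreover have "x \<in> ?V"
      using x V by simp
    moreover have "y z \<in> N" if z: "z \<in> ?V" for z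
    proof -
      let ?w = "s (inverse ?c) (z - x)"
      have w: "?w \<in> W" "?w \<in> topspace T"
        using z V x topspace_closed by auto
      have "z = x + s ?c ?w"
        using c(1) by (simp del: of_real_divide)
      then have "y z = y x + ?c * y ?w"
        using lin x w topspace_closed(3) by metis
      then have "dist (y z) (y x) = norm (?c) * norm (y ?w)"
        by (simp only: dist_norm norm_mult[symmetric] add_diff_cancel_left')
      also have "\<dots> \<le> norm ?c * 1"
        by (intro mult_left_mono y(3) w) auto
      finally show ?thesis
        using \<delta>(2) c(2) by simp
    qed
    ultimately show "\<exists>V'. openin T V' \<and> x \<in> V' \<and> V' \<subseteq> {x \<in> topspace T. y x \<in> N}"
      by blast
  qed
  then have "continuous_map T euclidean y"
    by (simp add: continuous_map)
  then show ?thesis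
    using y unfolding dual_def cont_linear_def by simp
qed

lemma dual_bounded:
  assumes y: "y \<in> dual s T"
  obtains W where "zero_nbhd T W" "y \<in> polar s T W"
proof -
  have "openin T {x \<in> topspace T. y x \<in> ball 0 1}"
    by (rule openin_continuous_map_preimage[OF dualD(3)[OF y]]) auto
  then have "zero_nbhd T {x \<in> topspace T. y x \<in> ball 0 1}"
    by (rule zero_nbhd_openin) (use topspace_closed dualD(5)[OF y] in auto)
  then show thesis
    by (rule that) (use y in \<open>auto simp: polar_def\<close>)
qed

lemma polar_mono: "V \<subseteq> W \<Longrightarrow> polar s T W \<subseteq> polar s T V"
  unfolding polar_def by blast

text \<open>Continuity is not preserved by pointwise limits in general, but a bound on
  \<open>W\<close> implies it for linear maps. The polar is thus cut out by conditions on finitely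
  many coordinates each, all of them closed.\<close>

lemma polar_eq_Inter:
  assumes "zero_nbhd T W"
  shows "polar s T W =
    (\<Inter>x\<in>topspace T. \<Inter>z\<in>topspace T. {y. y (x + z) = y x + y z}) \<inter>
    (\<Inter>c. \<Inter>x\<in>topspace T. {y. y (s c x) = c * y x}) \<inter>
    (\<Inter>x\<in>- topspace T. {y. y x = 0}) \<inter> (\<Inter>x\<in>W. {y. norm (y x) \<le> 1})"
    (is "_ = ?R")
proof
  show "polar s T W \<subseteq> ?R"
    using dualD unfolding polar_def by auto
  show "?R \<subseteq> polar s T W"
    unfolding polar_def using dualI[OF assms] by (auto simp: linear_map_on_def)
qed

lemma continuous_on_eval: "continuous_on A (\<lambda>y. y x)"
  by (rule continuous_on_subset[of UNIV]) (auto intro: continuous_on_product_coordinates)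

lemma closed_polar:
  assumes "zero_nbhd T W"
  shows "closed (polar s T W)"
  unfolding polar_eq_Inter[OF assms]
  by (intro closed_Int closed_INT ballI closed_Collect_eq closed_Collect_le
      continuous_on_add continuous_on_mult continuous_on_norm continuous_on_const continuous_on_eval)

text \<open>The Alaoglu-Bourbaki theorem: \<open>W\<close> is absorbing, which bounds every
  coordinate, so the polar is a closed subset of a product of compact balls.\<close>

lemma compact_polar:
  assumes W: "zero_nbhd T W"
  shows "compact (polar s T W)"
proof -
  have "\<exists>r. \<forall>y\<in>polar s T W. norm (y x) \<le> r" for x
  proof (cases "x \<in> topspace T")
    case True
    then obtain r where r: "r > 0" "\<And>r'. r \<le> r' \<Longrightarrow> x \<in> s (of_real r') ` W"
      using zero_nbhd_absorbing[OF W] by blast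
    then obtain w where w: "x = s (of_real r) w" "w \<in> W"
      by blast
    have "norm (y x) \<le> r" if "y \<in> polar s T W" for y
    proof -
      have "norm (y x) = r * norm (y w)"
        using that dualD(2)[of y] r w W unfolding polar_def zero_nbhd_def
        by (auto simp: norm_mult)
      also have "\<dots> \<le> r * 1"
        using that r w by (intro mult_left_mono) (auto simp: polar_def)
      finally show ?thesis by simp
    qed
    then show ?thesis by blast
  next
    case False
    then show ?thesis
      using dualD(4) unfolding polar_def by (intro exI[of _ 0]) auto
  qed
  then obtain r where r: "\<And>x y. y \<in> polar s T W \<Longrightarrow> norm (y x) \<le> r x"
    by metis
  have "compactin (product_topology (\<lambda>_. euclidean) UNIV) (Pi\<^sub>E UNIV (\<lambda>x. cball (0::'k) (r x)))"
    by (subst compactin_PiE) (use compact_cball_scalar in auto)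
  then have "compact (Pi\<^sub>E UNIV (\<lambda>x. cball (0::'k) (r x)))"
    by (simp add: euclidean_product_topology)
  moreover have "polar s T W \<subseteq> Pi\<^sub>E UNIV (\<lambda>x. cball 0 (r x))"
    using r by (auto simp: PiE_UNIV_domain)
  ultimately show ?thesis
    using closed_polar[OF W] by (metis compact_Int_closed inf.absorb_iff2)
qed

lemma dual_add: assumes "y \<in> dual s T" "z \<in> dual s T" shows "y + z \<in> dual s T"
proof -
  have "continuous_map T euclidean (\<lambda>x. y x + z x)"
    using assms dualD(3) by (intro continuous_map_add) auto
  then show ?thesis
    using dualD[OF assms(1)] dualD[OF assms(2)]
    unfolding dual_def cont_linear_def linear_map_on_def plus_fun_def
    by (auto simp: algebra_simps)
qed

lemma dual_scale: assumes "y \<in> dual s T" shows "fun_scale (*) c y \<in> dual s T"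
proof -
  have "continuous_map T euclidean (\<lambda>x. c * y x)"
    using continuous_map_compose[OF dualD(3)[OF assms], of euclidean "\<lambda>z. c * z"]
    by (auto simp: o_def continuous_intros)
  then show ?thesis
    using dualD[OF assms]
    unfolding dual_def cont_linear_def linear_map_on_def fun_scale_def
    by (auto simp: algebra_simps)
qed

lemma dual_diff: assumes "y \<in> dual s T" "z \<in> dual s T" shows "y - z \<in> dual s T"
proof -
  have "y - z = y + fun_scale (*) (- 1) z"
    by (auto simp: fun_scale_def)
  then show ?thesis
    using dual_add dual_scale assms by metis
qed

lemma dual_zero: "0 \<in> dual s T"
  unfolding dual_def cont_linear_def linear_map_on_def zero_fun_def by auto

end

section \<open>Compactness in Frechet-Schwartz spaces\<close>

context lcHs
begin

lemma abs_convex_closure_of: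
  assumes C: "abs_convex s C" "C \<subseteq> topspace T"
  shows "abs_convex s (T closure_of C)"
  unfolding abs_convex_def
proof (intro ballI allI impI)
  fix x y and a b :: 'k
  assume xy: "x \<in> T closure_of C" "y \<in> T closure_of C" and ab: "norm a + norm b \<le> 1"
  let ?f = "\<lambda>p. s a (fst p) + s b (snd p)"
  have "continuous_map (prod_topology T T) T ?f"
    by (intro continuous_map_plus continuous_map_scale_const continuous_map_fst continuous_map_snd)
  then have "?f ` (prod_topology T T closure_of (C \<times> C)) \<subseteq> T closure_of (?f ` (C \<times> C))"
    by (rule continuous_map_image_closure_subset)
  also have "\<dots> \<subseteq> T closure_of C"
    by (rule closure_of_mono) (use abs_convexD[OF C(1)] ab in auto)
  finally show "s a x + s b y \<in> T closure_of C"
    using xy unfolding closure_of_Times by force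
qed

lemma regular_closed_nbhd:
  assumes "regular_space T" "zero_nbhd T W"
  obtains C where "zero_nbhd T C" "abs_convex s C" "closedin T C" "C \<subseteq> W"
proof -
  obtain V where V: "openin T V" "0 \<in> V" "V \<subseteq> W"
    using assms(2) unfolding zero_nbhd_def by blast
  then obtain N D where D: "openin T N" "closedin T D" "0 \<in> N" "N \<subseteq> D" "D \<subseteq> V"
    using assms(1) unfolding neighbourhood_base_of_closedin[symmetric] neighbourhood_base_of
    by meson
  have "zero_nbhd T D"
    using D unfolding zero_nbhd_def by (auto dest: closedin_subset)
  then obtain C where C: "abs_convex s C" "zero_nbhd T C" "C \<subseteq> D"
    using locally_convex by blast
  have CT: "C \<subseteq> topspace T"
    using C(2) unfolding zero_nbhd_def by blast
  show thesis
  proof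
    show "zero_nbhd T (T closure_of C)"
      using C(2) closure_of_subset[OF CT] by (rule zero_nbhd_mono) (rule closure_of_subset_topspace)
    show "abs_convex s (T closure_of C)"
      using C(1) CT by (rule abs_convex_closure_of)
    show "T closure_of C \<subseteq> W"
      using closure_of_minimal[OF C(3) D(2)] D(5) V(3) by blast
  qed simp
qed

text \<open>First countability and regularity yield countably many closed absolutely convex
  neighbourhoods; finite intersections make them decrease. \<open>W 0\<close> is the empty
  intersection.\<close>

lemma metrizable_nbhd_base:
  assumes "metrizable_space T"
  obtains W :: "nat \<Rightarrow> 'v set" where "W 0 = topspace T" "\<And>n. zero_nbhd T (W n)"
    "\<And>n. abs_convex s (W n)" "\<And>n. closedin T (W n)" "\<And>m n. m \<le> n \<Longrightarrow> W n \<subseteq> W m"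
    "\<And>V. zero_nbhd T V \<Longrightarrow> \<exists>n. W n \<subseteq> V"
proof -
  obtain \<B> where \<B>: "countable \<B>" "\<And>V. V \<in> \<B> \<Longrightarrow> openin T V"
      "\<And>U. openin T U \<Longrightarrow> 0 \<in> U \<Longrightarrow> \<exists>V\<in>\<B>. 0 \<in> V \<and> V \<subseteq> U"
    using metrizable_imp_first_countable[OF assms] topspace_closed(1)
    unfolding first_countable_def by metis
  let ?\<B> = "{V\<in>\<B>. 0 \<in> V}"
  have ne: "?\<B> \<noteq> {}" "countable ?\<B>"
    using \<B>(1) \<B>(3)[OF openin_topspace topspace_closed(1)] by auto
  have B: "zero_nbhd T (from_nat_into ?\<B> n)" for n
    using from_nat_into[OF ne(1), of n] \<B>(2) by (auto intro: zero_nbhd_openin)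
  have "\<exists>C. zero_nbhd T C \<and> abs_convex s C \<and> closedin T C \<and> C \<subseteq> from_nat_into ?\<B> n" for n
    by (rule regular_closed_nbhd[OF metrizable_imp_regular_space[OF assms] B[of n]]) blast
  then obtain C where C: "\<And>n. zero_nbhd T (C n)" "\<And>n. abs_convex s (C n)"
      "\<And>n. closedin T (C n)" "\<And>n. C n \<subseteq> from_nat_into ?\<B> n"
    by metis
  define W where "W n = topspace T \<inter> (\<Inter>i<n. C i)" for n
  have W_Suc: "W (Suc n) = C n \<inter> W n" for n
    unfolding W_def by (auto simp: lessThan_Suc)
  have W0: "W 0 = topspace T"
    unfolding W_def by simp
  show thesis
  proof
    show "W 0 = topspace T"
      by (rule W0)
    show "zero_nbhd T (W n)" for n
      by (induction n) (auto simp: W0 W_Suc zero_nbhd_topspace intro: zero_nbhd_Int C)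
    show "abs_convex s (W n)" for n
      by (induction n) (auto simp: W0 W_Suc abs_convex_topspace intro: abs_convex_Int C)
    show "closedin T (W n)" for n
      by (induction n) (auto simp: W0 W_Suc intro: closedin_Int C)
    show "W n \<subseteq> W m" if "m \<le> n" for m n
      using that unfolding W_def by auto
  next
    fix V assume "zero_nbhd T V"
    then obtain U where U: "openin T U" "0 \<in> U" "U \<subseteq> V"
      unfolding zero_nbhd_def by blast
    then obtain B where "B \<in> ?\<B>" "B \<subseteq> U"
      using \<B>(3)[of U] by auto
    then obtain n where "from_nat_into ?\<B> n = B"
      using from_nat_into_surj[OF ne(2)] by blast
    \<comment> \<open>\<open>W n\<close> only involves the sets \<open>C i\<close> with
      \<open>i < n\<close>, hence the shift.\<close>
    then have "W (Suc n) \<subseteq> V"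
      using W_Suc C(4)[of n] \<open>B \<subseteq> U\<close> U(3) by blast
    then show "\<exists>n. W n \<subseteq> V" ..
  qed
qed

text \<open>Bounded sets are precompact: \<open>B\<close> lies in a multiple \<open>r\<close> of the
  neighbourhood \<open>V\<close> given by the Schwartz property, and a cover of \<open>V\<close>
  with \<epsilon> equal to \<open>inverse r\<close> scales up to a cover of \<open>B\<close> by
  translates of \<open>W\<close>.\<close>

lemma schwartz_bounded_cover:
  assumes S: "schwartz s T" and B: "vN_bounded s T B" and W: "zero_nbhd T W" "abs_convex s W"
  obtains A where "finite A" "B \<subseteq> (\<Union>a\<in>A. (\<lambda>w. a + w) ` W)"
proof -
  obtain V where V: "zero_nbhd T V" and cover: "\<And>\<epsilon>::real. \<epsilon> > 0 \<Longrightarrow> \<exists>A. finite A \<and> A \<subseteq> V \<and>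
              V \<subseteq> (\<Union>a\<in>A. (\<lambda>w. a + s (of_real \<epsilon>) w) ` W)"
    using S W unfolding schwartz_def by meson
  obtain r where r: "r > 0" "B \<subseteq> s (of_real r) ` V"
    using B V unfolding vN_bounded_def by blast
  obtain A where A: "finite A" "V \<subseteq> (\<Union>a\<in>A. (\<lambda>w. a + s (of_real (inverse r)) w) ` W)"
    using cover[of "inverse r"] r(1) by auto
  show thesis
  proof
    show "finite (s (of_real r) ` A)"
      using A by simp
    show "B \<subseteq> (\<Union>a\<in>s (of_real r) ` A. (\<lambda>w. a + w) ` W)"
    proof
      fix x assume "x \<in> B"
      then obtain v where v: "v \<in> V" "x = s (of_real r) v"
        using r by blast
      then obtain a w where "a \<in> A" "w \<in> W" "v = a + s (of_real (inverse r)) w"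
        using A by blast
      then have "a \<in> A" "w \<in> W" "x = s (of_real r) a + w"
        using v r(1) by (auto simp: scale_right_distrib)
      then show "x \<in> (\<Union>a\<in>s (of_real r) ` A. (\<lambda>w. a + w) ` W)"
        by blast
    qed
  qed
qed

text \<open>These spaces are Montel. Precompactness and a diagonal argument extract a Cauchy
  subsequence, which converges by completeness; in a metrizable space this sequential compactness
  suffices.\<close>

lemma frechet_schwartz_compactin:
  assumes "frechet s T" "schwartz s T" and B: "closedin T B" "vN_bounded s T B"
  shows "compactin T B"
proof -
  have met: "metrizable_space T"
    using assms(1) unfolding frechet_def by blast
  then obtain W :: "nat \<Rightarrow> 'v set" where W: "\<And>n. zero_nbhd T (W n)"
    "\<And>n. abs_convex s (W n)" "\<And>m n. m \<le> n \<Longrightarrow> W n \<subseteq> W m" "\<And>V. zero_nbhd T V \<Longrightarrow> \<exists>n. W n \<subseteq> V"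
    using metrizable_nbhd_base by metis
  have "\<exists>l r. l \<in> B \<and> strict_mono r \<and> limitin T (\<sigma> \<circ> r) l sequentially"
    if \<sigma>: "range \<sigma> \<subseteq> B" for \<sigma> :: "nat \<Rightarrow> 'v"
  proof -
    \<comment> \<open>The property handed to the diagonal argument; it is inherited by
      subsequences.\<close>
    define P where "P n t \<longleftrightarrow> (\<forall>i j. \<sigma> (t i) - \<sigma> (t j) \<in> W n)" for n and t :: "nat \<Rightarrow> nat"
    have "\<exists>r'. strict_mono r' \<and> P n (t \<circ> r')" for n and t :: "nat \<Rightarrow> nat"
    proof -
      \<comment> \<open>Halving: two points in the same translate of half of \<open>W n\<close>
        differ by an element of \<open>W n\<close>.\<close>
      let ?h = "of_real (1/2) :: 'k"
      let ?W = "s ?h ` W n"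
      have h: "?h \<noteq> 0" "norm ?h = 1/2"
        by (simp, metis norm_of_real abs_of_nonneg zero_le_divide_1_iff zero_le_numeral)
      obtain A where A: "finite A" "B \<subseteq> (\<Union>a\<in>A. (\<lambda>w. a + w) ` ?W)"
        by (rule schwartz_bounded_cover[OF assms(2) B(2) zero_nbhd_scaled[OF W(1)[of n] h(1)]
              abs_convex_scaled[OF W(2)]])
      have "\<forall>i. \<exists>a\<in>A. \<sigma> (t i) - a \<in> ?W"
      proof
        fix i
        have "\<sigma> (t i) \<in> B"
          using \<sigma> by auto
        then obtain a w where "a \<in> A" "w \<in> ?W" "\<sigma> (t i) = a + w"
          using A(2) by blast
        then show "\<exists>a\<in>A. \<sigma> (t i) - a \<in> ?W"
          by (intro bexI[of _ a]) (simp_all only: add_diff_cancel_left')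
      qed
      then obtain a where a: "\<And>i. a i \<in> A" "\<And>i. \<sigma> (t i) - a i \<in> ?W"
        by metis
      \<comment> \<open>Only finitely many centres occur, so one of them serves infinitely many
        indices.\<close>
      then have "finite (range a)"
        using A(1) by (meson finite_subset image_subsetI)
      then obtain i0 where "infinite {i. a i = a i0}"
        using pigeonhole_infinite[OF infinite_UNIV_nat, of a] by auto
      from infinite_enumerate[OF this]
      obtain r' :: "nat \<Rightarrow> nat" where "strict_mono r'" "\<forall>i. r' i \<in> {i. a i = a i0}"
        by blast
      then have r': "strict_mono r'" "a (r' i) = a i0" for i
        by simp_all
      have "P n (t \<circ> r')"
        unfolding P_def
      proof (intro allI)
        fix i j
        obtain v w where v: "v \<in> W n" "\<sigma> (t (r' i)) - a i0 = s ?h v"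
          and w: "w \<in> W n" "\<sigma> (t (r' j)) - a i0 = s ?h w"
          using a(2)[of "r' i"] a(2)[of "r' j"] r'(2) by auto
        have "\<sigma> (t (r' i)) - \<sigma> (t (r' j)) = s ?h v - s ?h w"
          using v(2) w(2) by (metis diff_add_cancel add_diff_cancel_right diff_diff_eq2)
        also have "\<dots> = s ?h v + s (- ?h) w"
          by (simp only: scale_minus_left diff_conv_add_uminus)
        also have "\<dots> \<in> W n"
          by (rule abs_convexD[OF W(2) v(1) w(1)]) (use h(2) in simp)
        finally show "\<sigma> ((t \<circ> r') i) - \<sigma> ((t \<circ> r') j) \<in> W n"
          by simp
      qed
      with r'(1) show ?thesis
        by blast
    qed
    then interpret subseqs P
      by unfold_locales
    \<comment> \<open>The diagonal sequence satisfies \<open>P n\<close> only from index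
      \<open>Suc n\<close> on, after the extraction that achieved \<open>P n\<close>.\<close>
    have diag_holds: "P n (diagseq \<circ> (+) (Suc n))" for n
      by (rule diagseq_holds) (simp add: P_def)
    have diag: "\<sigma> (diagseq i) - \<sigma> (diagseq j) \<in> W n" if "i > n" "j > n" for i j n
    proof -
      have "\<sigma> (diagseq (Suc n + (i - Suc n))) - \<sigma> (diagseq (Suc n + (j - Suc n))) \<in> W n"
        using diag_holds[of n] unfolding P_def o_def by blast
      then show ?thesis
        using that by simp
    qed
    have "\<exists>N. \<forall>i\<ge>N. \<forall>j\<ge>N. (\<sigma> \<circ> diagseq) i - (\<sigma> \<circ> diagseq) j \<in> V" if V: "zero_nbhd T V" for V
    proof -
      obtain n where "W n \<subseteq> V"
        using W(4)[OF V] by blast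
      then show ?thesis
        using diag[of n] by (intro exI[of _ "Suc n"]) auto
    qed
    moreover have "range (\<sigma> \<circ> diagseq) \<subseteq> topspace T"
      using \<sigma> closedin_subset[OF B(1)] by auto
    ultimately obtain l where l: "limitin T (\<sigma> \<circ> diagseq) l sequentially"
      using assms(1) unfolding frechet_def by blast
    then have "l \<in> B"
      by (rule limitin_closedin[OF _ B(1)]) (use \<sigma> in \<open>auto intro!: always_eventually\<close>)
    then show ?thesis
      using l subseq_diagseq by blast
  qed
  moreover obtain M d where "Metric_space M d" "T = Metric_space.mtopology M d"
    using met unfolding metrizable_space_def by blast
  ultimately show ?thesis
    using Metric_space.compactin_sequentially[of M d B] closedin_subset[OF B(1)]
      Metric_space.topspace_mtopology[of M d] by simp
qed

section \<open>The Banach-Dieudonne theorem\<close>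

text \<open>A nonzero value could be rescaled to \<open>2\<close> within the carrier.\<close>

lemma polar_topspace: "polar s T (topspace T) \<subseteq> {0}"
proof
  fix y assume y: "y \<in> polar s T (topspace T)"
  then have yd: "y \<in> dual s T"
    unfolding polar_def by blast
  have "y x = 0" if x: "x \<in> topspace T" for x
  proof (rule ccontr)
    assume "y x \<noteq> 0"
    moreover have "norm (y (s (2 / y x) x)) \<le> 1"
      using y topspace_closed(3)[OF x] unfolding polar_def by blast
    ultimately show False
      by (simp add: dualD(2)[OF yd x])
  qed
  then have "y = 0"
    using dualD(4)[OF yd] by (auto simp: fun_eq_iff)
  then show "y \<in> {0}"
    by simp
qed

text \<open>Weak* compactness: if every finite \<open>A\<close> failed, the finite intersection
  property would give a point of \<open>C\<close> bounded by \<open>1\<close> on \<open>P\<close>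
  and on all of \<open>V\<close>, which \<open>empty\<close> excludes.\<close>

lemma Banach_Dieudonne_step:
  assumes C: "closed (C \<inter> polar s T W)" and W: "zero_nbhd T W"
    and empty: "C \<inter> polar s T V \<inter> {y. \<forall>x\<in>P. norm (y x) \<le> 1} = {}"
    and CD: "C \<subseteq> dual s T"
  obtains A where "finite A" "A \<subseteq> V" "C \<inter> polar s T W \<inter> {y. \<forall>x\<in>P \<union> A. norm (y x) \<le> 1} = {}"
proof (rule ccontr)
  note that' = that
  assume neg: "\<not> thesis"
  let ?H = "\<lambda>x. {y :: 'v \<Rightarrow> 'k. norm (y x) \<le> 1}"
  have closed: "closed (?H x)" for x
    by (intro closed_Collect_le continuous_on_norm continuous_on_eval continuous_on_const)
  let ?S = "(C \<inter> polar s T W) \<inter> (\<Inter>x\<in>P. ?H x)"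
  have "compact (polar s T W \<inter> ((C \<inter> polar s T W) \<inter> (\<Inter>x\<in>P. ?H x)))"
    by (intro compact_Int_closed[OF compact_polar[OF W]] closed_Int[OF C] closed_INT ballI closed)
  moreover have "polar s T W \<inter> ((C \<inter> polar s T W) \<inter> (\<Inter>x\<in>P. ?H x)) = ?S"
    by blast
  ultimately have compact: "compact ?S"
    by simp
  have fip: "?S \<inter> \<Inter>\<A> \<noteq> {}" if \<A>: "finite \<A>" "\<A> \<subseteq> ?H ` V" for \<A>
  proof -
    obtain A where A: "finite A" "A \<subseteq> V" "\<A> = ?H ` A"
      using finite_subset_image[OF \<A>] by blast
    have "C \<inter> polar s T W \<inter> {y. \<forall>x\<in>P \<union> A. norm (y x) \<le> 1} \<noteq> {}"
      using neg that'[OF A(1,2)] by blast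
    then show ?thesis
      unfolding A(3) by blast
  qed
  have "?S \<inter> \<Inter>(?H ` V) \<noteq> {}"
    by (rule compact_imp_fip[OF compact _ fip]) (use closed in auto)
  then obtain y where "y \<in> C" "\<forall>x\<in>P. norm (y x) \<le> 1" "\<forall>x\<in>V. norm (y x) \<le> 1"
    by auto
  then have "y \<in> C \<inter> polar s T V \<inter> {y. \<forall>x\<in>P. norm (y x) \<le> 1}"
    using CD by (auto simp: polar_def)
  then show False
    unfolding empty by simp
qed

text \<open>Finite sets \<open>P n\<close> are built so that each element of \<open>C\<close> in the
  polar of \<open>W n\<close> exceeds \<open>1\<close> somewhere on \<open>P n\<close>. Points added
  from stage \<open>n\<close> on come from \<open>W n\<close>, so all \<open>P n\<close> together
  lie in one bounded closed disk \<open>K\<close>, which is compact.\<close>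

theorem Banach_Dieudonne:
  assumes FS: "frechet s T" "schwartz s T" and CD: "C \<subseteq> dual s T" and "0 \<notin> C"
    and closed: "\<And>W. zero_nbhd T W \<Longrightarrow> closed (C \<inter> polar s T W)"
  obtains K where "abs_convex s K" "compactin T K" "\<forall>y\<in>C. \<exists>x\<in>K. norm (y x) > 1"
proof -
  have met: "metrizable_space T"
    using FS(1) unfolding frechet_def by blast
  obtain W :: "nat \<Rightarrow> 'v set" where W: "W 0 = topspace T" "\<And>n. zero_nbhd T (W n)"
    "\<And>n. abs_convex s (W n)" "\<And>n. closedin T (W n)" "\<And>m n. m \<le> n \<Longrightarrow> W n \<subseteq> W m"
    "\<And>V. zero_nbhd T V \<Longrightarrow> \<exists>n. W n \<subseteq> V"
    by (rule metrizable_nbhd_base[OF met], rule that) assumption+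
  have WT: "W n \<subseteq> topspace T" for n
    using W(2)[of n] unfolding zero_nbhd_def by blast
  \<comment> \<open>The choice \<open>W 0 = topspace T\<close>, with polar \<open>{0}\<close>, lets the recursion start from the empty set.\<close>
  let ?Q = "\<lambda>n P. finite P \<and> P \<subseteq> topspace T \<and>
    C \<inter> polar s T (W n) \<inter> {y. \<forall>x\<in>P. norm (y x) \<le> 1} = {}"
  have "\<exists>P. \<forall>n. ?Q n (P n) \<and> (P n \<subseteq> P (Suc n) \<and> P (Suc n) \<subseteq> P n \<union> W n)"
  proof (rule dependent_nat_choice)
    show "\<exists>P. ?Q 0 P"
      using polar_topspace \<open>0 \<notin> C\<close> by (intro exI[of _ "{}"]) (auto simp: W(1))
  next
    fix P n assume P: "?Q n P"
    then have empty: "C \<inter> polar s T (W n) \<inter> {y. \<forall>x\<in>P. norm (y x) \<le> 1} = {}"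
      by blast
    obtain A where "finite A" "A \<subseteq> W n"
        "C \<inter> polar s T (W (Suc n)) \<inter> {y. \<forall>x\<in>P \<union> A. norm (y x) \<le> 1} = {}"
      by (rule Banach_Dieudonne_step[OF closed[OF W(2)[of "Suc n"]] W(2) empty CD])
    then show "\<exists>P'. ?Q (Suc n) P' \<and> P \<subseteq> P' \<and> P' \<subseteq> P \<union> W n"
      using P WT[of n] by (intro exI[of _ "P \<union> A"] conjI) (simp_all add: le_supI2)
  qed
  then obtain P where P': "\<forall>n. ?Q n (P n) \<and> (P n \<subseteq> P (Suc n) \<and> P (Suc n) \<subseteq> P n \<union> W n)"
    by (rule exE)
  have P: "?Q n (P n)" "P n \<subseteq> P (Suc n) \<and> P (Suc n) \<subseteq> P n \<union> W n" for n
    by (rule conjunct1[OF spec[OF P']], rule conjunct2[OF spec[OF P']])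
  \<comment> \<open>For \<open>m\<close> beyond \<open>n\<close> the new points come from
    \<open>W n\<close>, because the sets \<open>W n\<close> decrease.\<close>
  have P_sub: "P m \<subseteq> P n \<union> W n" for m n
  proof (cases "m \<le> n")
    case True
    then have "P m \<subseteq> P n"
      by (rule lift_Suc_mono_le[rotated]) (use P(2) in blast)
    then show ?thesis by blast
  next
    case False
    then have "n \<le> m" by simp
    then show ?thesis
    proof (induction m rule: dec_induct)
      case (step m)
      then show ?case
        using P(2)[of m] W(5)[of n m] by auto
    qed simp
  qed
  \<comment> \<open>With \<open>r \<ge> 1\<close> the multiple of \<open>W n\<close> contains
    \<open>W n\<close> as well as \<open>P n\<close>, and so every \<open>P m\<close> by
    \<open>P_sub\<close>.\<close>
  have "\<exists>r\<ge>1::real. P n \<subseteq> s (of_real r) ` W n" for n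
    by (rule zero_nbhd_absorbing_finite[OF W(2)[of n] W(3)[of n], of "P n"]) (use P(1)[of n] in blast)+
  then obtain r where r: "\<And>n. r n \<ge> (1::real)" "\<And>n. P n \<subseteq> s (of_real (r n)) ` W n"
    by metis
  have r0: "of_real (r n) \<noteq> (0::'k)" for n
    using r(1)[of n] by simp
  have "W n \<subseteq> s (of_real (r n)) ` W n" for n
    using abs_convex_scaled_mono[OF W(3), of 1 "r n" _ n] r(1)[of n] by auto
  then have P_sub': "P m \<subseteq> s (of_real (r n)) ` W n" for m n
    using P_sub r(2) by blast
  \<comment> \<open>This replaces the closed absolutely convex hull of all \<open>P n\<close>: it
    contains them, and closedness, absolute convexity and boundedness can be read off the
    intersection.\<close>
  define K where "K = (\<Inter>n. s (of_real (r n)) ` W n)"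
  show thesis
  proof
    show "abs_convex s K"
      unfolding K_def by (intro abs_convex_INT abs_convex_scaled W(3))
    show "compactin T K"
    proof (rule frechet_schwartz_compactin[OF FS])
      have "closedin T (s (of_real (r n)) ` W n)" for n
      proof -
        have "closedin T {x \<in> topspace T. s (inverse (of_real (r n))) x \<in> W n}"
          by (rule closedin_continuous_map_preimage[OF _ W(4)])
            (rule continuous_map_scale_const, simp)
        moreover have "{x \<in> topspace T. s (inverse (of_real (r n))) x \<in> W n} =
            s (of_real (r n)) ` W n"
          using in_scaled_iff[OF r0] topspace_closed(3)[OF subsetD[OF WT[of n]]] by auto
        ultimately show ?thesis
          by simp
      qed
      then show "closedin T K"
        unfolding K_def by (intro closedin_INT) auto
      have "\<exists>r>0. K \<subseteq> s (of_real r) ` V" if V: "zero_nbhd T V" for V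
      proof -
        obtain n where "W n \<subseteq> V"
          using W(6)[OF V] by blast
        then have "K \<subseteq> s (of_real (r n)) ` V"
          unfolding K_def by blast
        then show ?thesis
          using r(1)[of n] by (intro exI[of _ "r n"]) auto
      qed
      then show "vN_bounded s T K"
        using closedin_subset[OF \<open>closedin T K\<close>] unfolding vN_bounded_def by blast
    qed
    show "\<forall>y\<in>C. \<exists>x\<in>K. norm (y x) > 1"
    proof
      fix y assume y: "y \<in> C"
      then obtain V where "zero_nbhd T V" "y \<in> polar s T V"
        using dual_bounded CD by blast
      then obtain n where "y \<in> polar s T (W n)"
        using W(6) polar_mono by blast
      then obtain x where "x \<in> P n" "\<not> norm (y x) \<le> 1"
        using P(1)[of n] y by blast
      then show "\<exists>x\<in>K. norm (y x) > 1"
        using P_sub'[of n] unfolding K_def by force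
    qed
  qed
qed

section \<open>Uniform approximation in weak* closures\<close>

text \<open>On a polar, weak* closeness at finitely many points is closeness on \<open>V\<close>:
  the Schwartz property covers \<open>V\<close> by small translates of \<open>W'\<close>, and
  functionals in the polar vary little within each translate.\<close>

lemma schwartz_polar_approximation:
  assumes S: "schwartz s T" and W: "zero_nbhd T W"
  obtains V where "zero_nbhd T V" "abs_convex s V" "V \<subseteq> W"
    "\<And>A y \<epsilon>. A \<subseteq> polar s T W \<Longrightarrow> y \<in> closure A \<Longrightarrow> \<epsilon> > 0 \<Longrightarrow> \<exists>z\<in>A. \<forall>x\<in>V. norm (y x - z x) \<le> \<epsilon>"
proof -
  obtain W' where W': "zero_nbhd T W'" "abs_convex s W'" "W' \<subseteq> W"
    using locally_convex[OF W] by blast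
  then obtain V' where V': "zero_nbhd T V'" and cover: "\<And>\<epsilon>::real. \<epsilon> > 0 \<Longrightarrow> \<exists>A. finite A \<and> A \<subseteq> V' \<and>
              V' \<subseteq> (\<Union>a\<in>A. (\<lambda>w. a + s (of_real \<epsilon>) w) ` W')"
    using S unfolding schwartz_def by meson
  obtain V where V: "abs_convex s V" "zero_nbhd T V" "V \<subseteq> W' \<inter> V'"
    using locally_convex[OF zero_nbhd_Int[OF W'(1) V']] by blast
  show thesis
  proof
    fix A y and \<epsilon> :: real
    assume A: "A \<subseteq> polar s T W" and y: "y \<in> closure A" and \<epsilon>: "\<epsilon> > 0"
    \<comment> \<open>\<open>y\<close> and \<open>z\<close> are bounded by \<open>1\<close> on
      \<open>W'\<close>, so \<open>y - z\<close> is bounded by \<open>2\<close> there and the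
      remainder costs at most \<open>\<epsilon> / 2\<close>; the other half is spent at the
      centres.\<close>
    obtain B where B: "finite B" "B \<subseteq> V'" "V' \<subseteq> (\<Union>a\<in>B. (\<lambda>w. a + s (of_real (\<epsilon> / 4)) w) ` W')"
      using cover[of "\<epsilon> / 4"] \<epsilon> by auto
    have AW': "A \<subseteq> polar s T W'"
      using A polar_mono[OF W'(3)] by blast
    have yW': "y \<in> polar s T W'"
      using closure_minimal[OF AW' closed_polar[OF W'(1)]] y by blast
    have "open (\<Inter>b\<in>B. {z :: 'v \<Rightarrow> 'k. norm (y b - z b) < \<epsilon> / 2})"
      using B(1) by (intro open_INT ballI open_Collect_less continuous_on_norm continuous_on_diff
          continuous_on_const continuous_on_eval) auto
    moreover have "y \<in> (\<Inter>b\<in>B. {z. norm (y b - z b) < \<epsilon> / 2})"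
      using \<epsilon> by simp
    ultimately obtain z where z: "z \<in> A" "\<And>b. b \<in> B \<Longrightarrow> norm (y b - z b) < \<epsilon> / 2"
      using y open_Int_closure_eq_empty[of "\<Inter>b\<in>B. {z :: 'v \<Rightarrow> 'k. norm (y b - z b) < \<epsilon> / 2}" A]
      by blast
    have d: "y - z \<in> dual s T"
      using z(1) AW' yW' dual_diff unfolding polar_def by blast
    have "norm (y x - z x) \<le> \<epsilon>" if x: "x \<in> V" for x
    proof -
      obtain b w where b: "b \<in> B" and w: "w \<in> W'" and xbw: "x = b + s (of_real (\<epsilon> / 4)) w"
        using x V(3) B(3) by blast
      have T: "b \<in> topspace T" "w \<in> topspace T"
        using b w B(2) V' W'(1) unfolding zero_nbhd_def by blast+
      have "norm (y w) \<le> 1" "norm (z w) \<le> 1"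
        using yW' z(1) AW' w unfolding polar_def by auto
      then have "norm (y w - z w) \<le> 2"
        using norm_triangle_ineq4[of "y w" "z w"] by linarith
      then have "norm (of_real (\<epsilon> / 4) * (y w - z w)) \<le> \<epsilon> / 2"
        using \<epsilon> unfolding norm_mult norm_of_real by (simp add: field_simps)
      moreover have "y x - z x = (y b - z b) + of_real (\<epsilon> / 4) * (y w - z w)"
        using dualD(1)[OF d T(1) topspace_closed(3)[OF T(2)], of "of_real (\<epsilon> / 4)"]
          dualD(2)[OF d T(2), of "of_real (\<epsilon> / 4)"] unfolding xbw by simp
      ultimately show ?thesis
        using z(2)[OF b] norm_triangle_ineq[of "y b - z b" "of_real (\<epsilon> / 4) * (y w - z w)"]
        by (simp only:)
    qed
    with z(1) show "\<exists>z\<in>A. \<forall>x\<in>V. norm (y x - z x) \<le> \<epsilon>"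
      by blast
  qed (use V W' in auto)
qed

section \<open>Separation in the dual by a point of the space\<close>

text \<open>A finite moment problem of Helly type. The squared error attains its minimum on
  \<open>K\<close>; a positive minimum would produce coefficients \<open>c\<close> whose combination
  of the \<open>p y\<close> exceeds in norm the values of that combination on all of
  \<open>K\<close>, contrary to \<open>dominated\<close>.\<close>

lemma finite_interpolation:
  assumes K: "abs_convex s K" "compactin T K" "K \<noteq> {}" and Z: "finite Z" "Z \<subseteq> dual s T"
    and dominated: "\<And>c. (\<exists>y\<in>Z. c y \<noteq> 0) \<Longrightarrow> \<exists>x\<in>K. norm (\<Sum>y\<in>Z. c y * p y) \<le> norm (\<Sum>y\<in>Z. c y * y x)"
  obtains x where "x \<in> K" "\<And>y. y \<in> Z \<Longrightarrow> y x = (p y :: 'k)"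
proof -
  have KT: "K \<subseteq> topspace T"
    using K(2) by (rule compactin_subset_topspace)
  obtain \<phi> :: "'k \<Rightarrow> complex" where \<phi>: "\<And>x y. \<phi> (x + y) = \<phi> x + \<phi> y"
    "\<And>x y. \<phi> (x * y) = \<phi> x * \<phi> y" "\<And>x. norm (\<phi> x) = norm x" "\<And>x. \<exists>z. \<phi> z = cnj (\<phi> x)"
    "\<And>r. \<phi> (of_real r) = of_real r"
    by (rule scalar_embedding, rule that) assumption+
  have \<phi>0: "\<phi> 0 = 0"
    using \<phi>(3)[of 0] by simp
  have \<phi>diff: "\<phi> (x - y) = \<phi> x - \<phi> y" for x y
    using \<phi>(1)[of "x - y" y] by simp
  have \<phi>sum: "\<phi> (\<Sum>y\<in>Z. f y) = (\<Sum>y\<in>Z. \<phi> (f y))" for f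
    using Z(1) by (induction Z) (auto simp: \<phi>0 \<phi>(1))
  define q where "q x = (\<Sum>y\<in>Z. (norm (y x - p y))\<^sup>2)" for x
  have "continuous_map T euclidean q"
    unfolding q_def
  proof (rule continuous_map_sum[OF Z(1)])
    fix y assume "y \<in> Z"
    then have "continuous_map T euclidean y"
      using Z(2) dualD(3) by blast
    moreover have "continuous_map euclidean euclidean (\<lambda>z. (norm (z - p y))\<^sup>2)"
      unfolding continuous_map_iff_continuous2 by (intro continuous_intros)
    ultimately have "continuous_map T euclidean ((\<lambda>z. (norm (z - p y))\<^sup>2) \<circ> y)"
      by (rule continuous_map_compose)
    then show "continuous_map T euclidean (\<lambda>x. (norm (y x - p y))\<^sup>2)"
      by (simp only: o_def)
  qed
  then have "compact (q ` K)"
    using image_compactin[OF K(2), of euclidean q] by simp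
  then obtain x0 where x0: "x0 \<in> K" "\<And>x. x \<in> K \<Longrightarrow> q x0 \<le> q x"
    using compact_attains_inf[of "q ` K"] K(3) by auto
  \<comment> \<open>The first-order condition at the minimiser \<open>x0\<close> makes the residuals the coefficients of a
    functional that separates \<open>p\<close> from the values on \<open>K\<close>.\<close>
  define d where "d y = \<phi> (y x0 - p y)" for y
  have "\<forall>y. \<exists>c. \<phi> c = cnj (d y)"
    unfolding d_def using \<phi>(4) by blast
  then obtain c where c: "\<And>y. \<phi> (c y) = cnj (d y)"
    by metis
  define z where "z x = (\<Sum>y\<in>Z. c y * y x)" for x
  define R where "R = - Re (\<phi> (z x0))"
  \<comment> \<open>Moving from \<open>x0\<close> towards \<open>x\<close> stays in
    \<open>K\<close>, and by the choice of \<open>c\<close> the difference is half the derivative of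
    \<open>q\<close> in that direction.\<close>
  have slope: "0 \<le> Re (\<phi> (z x)) - Re (\<phi> (z x0))" if x: "x \<in> K" for x
  proof -
    define e where "e y = \<phi> (y x - y x0)" for y
    have "0 \<le> (\<Sum>y\<in>Z. Re (cnj (d y) * e y))"
    proof (rule quadratic_nonneg_slope)
      show "0 \<le> (\<Sum>y\<in>Z. (norm (e y))\<^sup>2)"
        by (simp add: sum_nonneg)
      fix t :: real assume t: "0 < t" "t \<le> 1"
      let ?x = "s (of_real (1 - t)) x0 + s (of_real t) x"
      have norms: "norm (of_real (1 - t) :: 'k) + norm (of_real t :: 'k) \<le> 1"
        using t unfolding norm_of_real by simp
      have "?x \<in> K"
        using abs_convexD[OF K(1) x0(1) x norms] .
      then have "q x0 \<le> q ?x"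
        by (rule x0)
      also have "q ?x = (\<Sum>y\<in>Z. (norm (d y))\<^sup>2 + 2 * t * Re (cnj (d y) * e y) + t\<^sup>2 * (norm (e y))\<^sup>2)"
        unfolding q_def
      proof (rule sum.cong[OF refl])
        fix y assume "y \<in> Z"
        then have y: "y \<in> dual s T"
          using Z(2) by blast
        have T: "x \<in> topspace T" "x0 \<in> topspace T"
          using x x0(1) KT by auto
        have "y ?x = of_real (1 - t) * y x0 + of_real t * y x"
          using dualD(1,2)[OF y] T topspace_closed(3) by metis
        then have "y ?x - p y = (y x0 - p y) + of_real t * (y x - y x0)"
          by (simp add: algebra_simps)
        then have y_step: "norm (y ?x - p y) = norm (d y + of_real t * e y)"
          unfolding d_def e_def using \<phi>(1,2,3,5) by metis
        show "(norm (y ?x - p y))\<^sup>2 =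
            (norm (d y))\<^sup>2 + 2 * t * Re (cnj (d y) * e y) + t\<^sup>2 * (norm (e y))\<^sup>2"
          unfolding y_step cmod_power2 by (simp add: power2_eq_square algebra_simps)
      qed
      also have "\<dots> = q x0 + 2 * t * (\<Sum>y\<in>Z. Re (cnj (d y) * e y)) + t\<^sup>2 * (\<Sum>y\<in>Z. (norm (e y))\<^sup>2)"
        by (simp only: q_def d_def \<phi>(3) sum.distrib sum_distrib_left)
      finally show "0 \<le> 2 * t * (\<Sum>y\<in>Z. Re (cnj (d y) * e y)) + t\<^sup>2 * (\<Sum>y\<in>Z. (norm (e y))\<^sup>2)"
        by simp
    qed
    also have "\<dots> = Re (\<phi> (z x)) - Re (\<phi> (z x0))"
      unfolding z_def \<phi>sum \<phi>(2) c e_def \<phi>diff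
      by (simp only: right_diff_distrib minus_complex.simps Re_sum sum_subtractf)
    finally show ?thesis .
  qed
  \<comment> \<open>\<open>slope\<close> bounds the real part of \<open>z\<close> below by
    \<open>- R\<close> on \<open>K\<close>. As \<open>K\<close> is balanced, \<open>x\<close> can be
    rotated until \<open>z\<close> is a nonpositive real; where \<open>z x = 0\<close>,
    \<open>slope\<close> at \<open>0\<close> gives \<open>R \<ge> 0\<close>.\<close>
  have z_le: "norm (z x) \<le> R" if x: "x \<in> K" for x
  proof (cases "z x = 0")
    case True
    have "0 \<in> K"
      using abs_convex_balanced[OF K(1) x, of 0] by simp
    moreover have "z 0 = 0"
      unfolding z_def using Z(2) dualD(5) by (intro sum.neutral) auto
    ultimately show ?thesis
      using slope[of 0] True \<phi>0 unfolding R_def by simp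
  next
    case False
    let ?a = "- of_real (norm (z x)) / z x"
    have "s ?a x \<in> K"
      by (rule abs_convex_balanced[OF K(1) x]) (simp add: norm_divide)
    moreover have "z (s ?a x) = ?a * z x"
      unfolding z_def sum_distrib_left
    proof (rule sum.cong[OF refl])
      fix y assume "y \<in> Z"
      then have "y (s a x) = a * y x" for a
        using dualD(2)[of y x] Z(2) x KT by blast
      then show "c y * y (s (- of_real (norm (\<Sum>y\<in>Z. c y * y x)) / (\<Sum>y\<in>Z. c y * y x)) x) =
        - of_real (norm (\<Sum>y\<in>Z. c y * y x)) / (\<Sum>y\<in>Z. c y * y x) * (c y * y x)"
        by (simp only: mult.left_commute)
    qed
    moreover have "?a * z x = of_real (- norm (z x))"
      using False by simp
    ultimately have "0 \<le> Re (\<phi> (of_real (- norm (z x)))) + R"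
      using slope[of "s ?a x"] unfolding R_def by simp
    then show ?thesis
      by (simp only: \<phi>(5)) simp
  qed
  \<comment> \<open>After cancelling \<open>q x0\<close> this says that the combination of the
    prescribed values exceeds the bound \<open>R\<close> of \<open>z\<close> on \<open>K\<close> by
    at least the squared error.\<close>
  have R: "q x0 + norm (\<Sum>y\<in>Z. c y * p y) \<ge> q x0 + (R + q x0)"
  proof -
    have "Re (\<phi> (z x0)) = (\<Sum>y\<in>Z. Re (cnj (d y) * d y)) + Re (\<phi> (\<Sum>y\<in>Z. c y * p y))"
      unfolding z_def \<phi>sum \<phi>(2) c Re_sum sum.distrib[symmetric]
      by (rule sum.cong) (auto simp: d_def \<phi>diff algebra_simps)
    also have "(\<Sum>y\<in>Z. Re (cnj (d y) * d y)) = q x0"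
      unfolding q_def d_def \<phi>(3)[symmetric] cmod_power2
      by (rule sum.cong) (auto simp: power2_eq_square)
    finally have "R + q x0 = - Re (\<phi> (\<Sum>y\<in>Z. c y * p y))"
      unfolding R_def by simp
    also have "\<dots> \<le> norm (\<Sum>y\<in>Z. c y * p y)"
      using abs_Re_le_cmod[of "\<phi> (\<Sum>y\<in>Z. c y * p y)"] unfolding \<phi>(3) by linarith
    finally show ?thesis
      by simp
  qed
  have "d y = 0" if y: "y \<in> Z" for y
  proof (rule ccontr)
    assume "d y \<noteq> 0"
    then have "norm (y x0 - p y) > 0" and cy: "c y \<noteq> 0"
      using \<phi>0 c[of y] \<phi>(3)[of "y x0 - p y"] unfolding d_def by auto
    then have "q x0 > 0"
      unfolding q_def using Z(1) y by (intro sum_pos2[of _ y]) auto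
    moreover obtain x where "x \<in> K" "norm (\<Sum>y\<in>Z. c y * p y) \<le> norm (z x)"
      using dominated[of c] cy y unfolding z_def by blast
    ultimately show False
      using z_le[of x] R by simp
  qed
  then have "y x0 = p y" if "y \<in> Z" for y
    using \<phi>(3)[of "y x0 - p y"] that unfolding d_def by simp
  then show thesis
    using that x0(1) by blast
qed

text \<open>The point has to solve the moment problem with value \<open>1\<close> at
  \<open>y0\<close> and \<open>0\<close> on \<open>Y\<close>. Finite parts are solvable in
  \<open>K\<close> because \<open>y0\<close> stays far from \<open>Y\<close> on \<open>K\<close>;
  compactness of \<open>K\<close> then solves all conditions at once.\<close>

lemma subspace_separation:
  assumes K: "abs_convex s K" "compactin T K" and Y: "Y \<subseteq> dual s T" "0 \<in> Y"
    "\<And>y z. y \<in> Y \<Longrightarrow> z \<in> Y \<Longrightarrow> y + z \<in> Y" "\<And>y c. y \<in> Y \<Longrightarrow> fun_scale (*) c y \<in> Y"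
    and y0: "y0 \<in> dual s T" and far: "\<And>y. y \<in> Y \<Longrightarrow> \<exists>x\<in>K. norm (y0 x - y x) > 1"
  obtains x where "x \<in> topspace T" "y0 x = 1" "\<And>y. y \<in> Y \<Longrightarrow> y x = 0"
proof -
  define p :: "('v \<Rightarrow> 'k) \<Rightarrow> 'k" where "p y = (if y = y0 then 1 else 0)" for y
  have y0Y: "y0 \<notin> Y"
    using far by force
  have K0: "K \<noteq> {}"
    using far Y(2) by blast
  have Ysum: "(\<lambda>x. \<Sum>y\<in>A. c y * y x) \<in> Y" if "finite A" "A \<subseteq> Y" for A c
    using that
  proof (induction A)
    case empty
    then show ?case
      using Y(2) by (simp add: zero_fun_def)
  next
    case (insert y A)
    have "(\<lambda>x. \<Sum>y\<in>insert y A. c y * y x) = fun_scale (*) (c y) y + (\<lambda>x. \<Sum>y\<in>A. c y * y x)"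
      using insert.hyps by (simp add: fun_eq_iff fun_scale_def)
    then show ?case
      using insert Y(3,4) by simp
  qed
  have interp: "\<exists>x\<in>K. \<forall>y\<in>Z. y x = p y" if Z: "finite Z" "Z \<subseteq> insert y0 Y" for Z
  proof -
    have "\<exists>x\<in>K. norm (\<Sum>y\<in>insert y0 Z. c y * p y) \<le> norm (\<Sum>y\<in>insert y0 Z. c y * y x)" for c
    proof -
      have split: "(\<Sum>y\<in>insert y0 Z. c y * g y) = c y0 * g y0 + (\<Sum>y\<in>Z - {y0}. c y * g y)"
        for g :: "('v \<Rightarrow> 'k) \<Rightarrow> 'k"
        using Z(1) by (rule sum.insert_remove)
      have p: "(\<Sum>y\<in>insert y0 Z. c y * p y) = c y0"
        unfolding split by (simp add: p_def)
      show ?thesis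
      proof (cases "c y0 = 0")
        case False
        \<comment> \<open>Dividing by \<open>c y0\<close> turns the combination into
          \<open>y0\<close> minus an element of \<open>Y\<close>, so \<open>far\<close> applies. If
          \<open>c y0 = 0\<close>, the prescribed combination is \<open>0\<close> and any point of
          \<open>K\<close> will do.\<close>
        obtain x where x: "x \<in> K" "norm (y0 x - (\<Sum>y\<in>Z - {y0}. (- c y / c y0) * y x)) > 1"
          using far[OF Ysum[of "Z - {y0}" "\<lambda>y. - c y / c y0"]] Z by auto
        have "(\<Sum>y\<in>Z - {y0}. (- c y / c y0) * y x) = - (\<Sum>y\<in>Z - {y0}. c y * y x) / c y0"
          by (simp add: sum_divide_distrib sum_negf)
        then have "c y0 * (y0 x - (\<Sum>y\<in>Z - {y0}. (- c y / c y0) * y x)) = (\<Sum>y\<in>insert y0 Z. c y * y x)"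
          unfolding split using False by (simp add: distrib_left)
        then have "norm (\<Sum>y\<in>insert y0 Z. c y * y x) =
            norm (c y0) * norm (y0 x - (\<Sum>y\<in>Z - {y0}. (- c y / c y0) * y x))"
          by (simp only: norm_mult[symmetric])
        also have "\<dots> \<ge> norm (c y0) * 1"
          using x(2) by (intro mult_left_mono) auto
        finally show ?thesis
          using x(1) p by auto
      qed (use p K0 in auto)
    qed
    then obtain x where "x \<in> K" "\<And>y. y \<in> insert y0 Z \<Longrightarrow> y x = p y"
      using finite_interpolation[OF K K0, of "insert y0 Z" p] Z Y(1) y0 by blast
    then show ?thesis
      by blast
  qed
  \<comment> \<open>The solution sets of the single conditions; they are closed, and
    \<open>interp\<close> is their finite intersection property in \<open>K\<close>.\<close>
  define H where "H y = {x \<in> topspace T. y x = p y}" for y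
  have "closedin T (H y)" if "y \<in> insert y0 Y" for y
  proof -
    have "closedin T {x \<in> topspace T. y x \<in> {p y}}"
      using that Y(1) y0 dualD(3) by (intro closedin_continuous_map_preimage) auto
    then show ?thesis
      unfolding H_def by simp
  qed
  moreover have fip: "K \<inter> \<Inter>\<F> \<noteq> {}" if \<F>: "finite \<F>" "\<F> \<subseteq> H ` insert y0 Y" for \<F>
  proof -
    obtain Z where Z: "Z \<subseteq> insert y0 Y" "finite Z" "\<F> = H ` Z"
      using finite_subset_image[OF \<F>] by blast
    obtain x where "x \<in> K" "\<forall>y\<in>Z. y x = p y"
      using interp[OF Z(2,1)] by blast
    then have "x \<in> K \<inter> \<Inter>\<F>"
      using compactin_subset_topspace[OF K(2)] unfolding Z(3) H_def by blast
    then show ?thesis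
      by blast
  qed
  ultimately have "(\<forall>C\<in>H ` insert y0 Y. closedin T C) \<and>
      (\<forall>\<F>. finite \<F> \<and> \<F> \<subseteq> H ` insert y0 Y \<longrightarrow> K \<inter> \<Inter>\<F> \<noteq> {})"
    by blast
  then have "K \<inter> \<Inter>(H ` insert y0 Y) \<noteq> {}"
    by (rule mp[OF spec[OF conjunct2[OF K(2)[unfolded compactin_fip]]]])
  then obtain x where "x \<in> topspace T" "\<And>y. y \<in> insert y0 Y \<Longrightarrow> y x = p y"
    unfolding H_def by blast
  then show thesis
    using that y0Y unfolding p_def by fastforce
qed

end

section \<open>Banach disks and weak boundedness\<close>

context lcHs
begin

lemma abs_convex_scaled_diff:
  assumes D: "abs_convex s D" and x: "x \<in> s (of_real a) ` D" and y: "y \<in> s (of_real b) ` D"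
    and ab: "0 \<le> a" "0 \<le> b" "0 < a + b"
  shows "x - y \<in> s (of_real (a + b)) ` D"
proof -
  obtain v w where v: "v \<in> D" "x = s (of_real a) v" and w: "w \<in> D" "y = s (of_real b) w"
    using x y by blast
  have c: "of_real (a + b) \<noteq> (0::'k)"
    using ab by (metis of_real_eq_0_iff less_irrefl)
  have norms: "norm (of_real (a / (a + b)) :: 'k) + norm (- of_real (b / (a + b)) :: 'k) \<le> 1"
    using ab unfolding norm_minus_cancel norm_of_real by (simp add: add_divide_distrib[symmetric])
  have eq: "s (inverse (of_real (a + b))) (x - y) =
      s (of_real (a / (a + b))) v + s (- of_real (b / (a + b))) w"
    unfolding v w by (simp add: scale_right_diff_distrib divide_inverse mult_ac)
  show "x - y \<in> s (of_real (a + b)) ` D"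
    unfolding in_scaled_iff[OF c] eq using D v(1) w(1) norms by (rule abs_convexD)
qed

lemma disk_span_real:
  assumes "x \<in> disk_span s D" "abs_convex s D"
  obtains a where "a > 0" "x \<in> s (of_real a) ` D"
proof -
  obtain n d where n: "d \<in> D" "x = s (of_nat n) d"
    using assms(1) unfolding disk_span_def by blast
  \<comment> \<open>\<open>n\<close> may be \<open>0\<close>; passing to \<open>Suc n\<close> makes
    the factor positive.\<close>
  have "s (of_nat n / of_nat (Suc n)) d \<in> D"
    using assms(2) n(1) by (rule abs_convex_balanced) (simp add: norm_divide del: of_nat_Suc)
  moreover have "x = s (of_real (real (Suc n))) (s (of_nat n / of_nat (Suc n)) d)"
    unfolding n(2) by (simp add: nonzero_mult_div_cancel_left del: of_nat_Suc)
  ultimately have "x \<in> s (of_real (real (Suc n))) ` D"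
    by (rule rev_image_eqI)
  then show thesis
    by (rule that[rotated]) simp
qed

lemma disk_spanI:
  assumes "abs_convex s D" "x \<in> s (of_real a) ` D" "a > 0"
  shows "x \<in> disk_span s D"
proof -
  obtain n :: nat where n: "a \<le> real n"
    using real_arch_simple by blast
  have "x \<in> s (of_real (real n)) ` D"
    using assms(1,3) n assms(2) by (rule abs_convex_scaled_mono)
  then show ?thesis
    unfolding disk_span_def by auto
qed

lemma gauge_of_le:
  assumes "x \<in> s (of_real a) ` D" "a > 0"
  shows "gauge_of s D x \<le> a"
  unfolding gauge_of_def
  by (rule cInf_lower) (use assms in \<open>auto intro: bdd_belowI[of _ 0]\<close>)

text \<open>Transfers convergence in the gauge of a disk to the values of functionals bounded on
  it.\<close>

lemma norm_le_gauge_of: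
  assumes D: "abs_convex s D" "x \<in> disk_span s D" "D \<subseteq> topspace T"
    and y: "y \<in> dual s T" "\<And>d. d \<in> D \<Longrightarrow> norm (y d) \<le> R" "R > 0"
  shows "norm (y x) \<le> R * gauge_of s D x"
proof -
  have "norm (y x) / R \<le> gauge_of s D x"
    unfolding gauge_of_def
  proof (rule cInf_greatest)
    show "{t. 0 < t \<and> x \<in> s (of_real t) ` D} \<noteq> {}"
      by (rule disk_span_real[OF D(2,1)]) blast
    fix t assume "t \<in> {t. 0 < t \<and> x \<in> s (of_real t) ` D}"
    then obtain d where t: "t > 0" and d: "d \<in> D" "x = s (of_real t) d"
      by blast
    have "norm (y x) = t * norm (y d)"
      using dualD(2)[OF y(1), of d "of_real t"] d D(3) t by (auto simp: norm_mult)
    also have "\<dots> \<le> t * R"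
      using y(2)[OF d(1)] t by simp
    finally show "norm (y x) / R \<le> t"
      using y(3) by (simp add: field_simps)
  qed
  then show ?thesis
    using y(3) by (simp add: field_simps)
qed

text \<open>The hypothesis on \<open>B\<close> is boundedness in the weak topology of
  \<open>G\<close>, checked by induction over the sets generated by its subbasis.\<close>

lemma pointwise_bounded_imp_bounded:
  assumes G: "determines_boundedness s T G" "G \<subseteq> dual s T" "G \<noteq> {}"
    and B: "B \<subseteq> topspace T" "\<And>\<phi>. \<phi> \<in> G \<Longrightarrow> \<exists>r. \<forall>b\<in>B. norm (\<phi> b) \<le> r"
  shows "vN_bounded s T B"
proof -
  \<comment> \<open>Open sets need not be balanced, so the claim is strengthened to all larger
    factors; this lets the intersection case take the maximum.\<close>
  have "0 \<in> V \<longrightarrow> (\<exists>r>0. \<forall>t\<ge>r. B \<subseteq> s (of_real t) ` V)"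
    if "generate_topology_on {{x \<in> topspace T. \<phi> x \<in> W} | \<phi> W. \<phi> \<in> G \<and> open W} V" for V
    using that
  proof induction
    case (Int V W)
    show ?case
    proof
      assume "0 \<in> V \<inter> W"
      then obtain r r' where r: "r > 0" "\<And>t. t \<ge> r \<Longrightarrow> B \<subseteq> s (of_real t) ` V"
          and r': "r' > 0" "\<And>t. t \<ge> r' \<Longrightarrow> B \<subseteq> s (of_real t) ` W"
        using Int.IH by blast
      have "B \<subseteq> s (of_real t) ` (V \<inter> W)" if "t \<ge> max r r'" for t
      proof
        fix b assume "b \<in> B"
        moreover have "of_real t \<noteq> (0::'k)"
          using that r(1) by auto
        ultimately show "b \<in> s (of_real t) ` (V \<inter> W)"
          using r(2)[of t] r'(2)[of t] that in_scaled_iff[of "of_real t"] by auto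
      qed
      then show "\<exists>r>0. \<forall>t\<ge>r. B \<subseteq> s (of_real t) ` (V \<inter> W)"
        using r(1) by (intro exI[of _ "max r r'"]) auto
    qed
  next
    case (UN K)
    show ?case
    proof
      assume "0 \<in> \<Union>K"
      then obtain V where "V \<in> K" "0 \<in> V"
        by blast
      then obtain r where "r > 0" "\<forall>t\<ge>r. B \<subseteq> s (of_real t) ` V"
        using UN.IH by blast
      then show "\<exists>r>0. \<forall>t\<ge>r. B \<subseteq> s (of_real t) ` \<Union>K"
        using \<open>V \<in> K\<close> by (intro exI[of _ r]) blast
    qed
  next
    case (Basis V)
    then obtain \<phi> W where V: "V = {x \<in> topspace T. \<phi> x \<in> W}" and \<phi>: "\<phi> \<in> G" and W: "open W"
      by blast
    have \<phi>d: "\<phi> \<in> dual s T"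
      using \<phi> G(2) by blast
    obtain R where R: "\<And>b. b \<in> B \<Longrightarrow> norm (\<phi> b) \<le> R"
      using B(2)[OF \<phi>] by blast
    show ?case
    proof
      assume "0 \<in> V"
      then have "0 \<in> W"
        using V dualD(5)[OF \<phi>d] by simp
      then obtain \<delta> where \<delta>: "\<delta> > 0" "\<And>z. norm z < \<delta> \<Longrightarrow> z \<in> W"
        using W unfolding open_dist by (auto simp: dist_norm)
      have "B \<subseteq> s (of_real t) ` V" if t: "t \<ge> (\<bar>R\<bar> + 1) / \<delta>" for t
      proof
        fix b assume b: "b \<in> B"
        have "(\<bar>R\<bar> + 1) / \<delta> > 0"
          using \<delta>(1) by (intro divide_pos_pos) auto
        then have t0: "t > 0"
          using t by linarith
        have "norm (\<phi> b) < t * \<delta>"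
          using R[OF b] t \<delta>(1) by (simp add: field_simps)
        then have "norm (inverse (of_real t) * \<phi> b) < \<delta>"
          using t0 by (simp add: norm_divide divide_simps mult.commute)
        moreover have "\<phi> (s (inverse (of_real t)) b) = inverse (of_real t) * \<phi> b"
          using dualD(2)[OF \<phi>d] b B(1) by blast
        ultimately have "s (inverse (of_real t)) b \<in> V"
          unfolding V using \<delta>(2) b B(1) topspace_closed(3) by auto
        then show "b \<in> s (of_real t) ` V"
          using t0 by (subst in_scaled_iff) auto
      qed
      moreover have "(\<bar>R\<bar> + 1) / \<delta> > 0"
        using \<delta>(1) by (intro divide_pos_pos) auto
      ultimately show "\<exists>r>0. \<forall>t\<ge>r. B \<subseteq> s (of_real t) ` V"
        by blast
    qed
  qed simp
  then have nbhd: "\<exists>r>0. B \<subseteq> s (of_real r) ` V" if "openin (weak_topology T G) V" "0 \<in> V" for V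
    using that unfolding weak_topology_def openin_topology_generated_by_iff by blast
  \<comment> \<open>One member of \<open>G\<close> with the full preimage suffices; an empty
    \<open>G\<close> would generate a topology with empty carrier.\<close>
  have "topspace T \<subseteq> topspace (weak_topology T G)"
    unfolding weak_topology_def topology_generated_by_topspace using G(3) by blast
  moreover have "\<exists>r>0. B \<subseteq> s (of_real r) ` W" if "zero_nbhd (weak_topology T G) W" for W
    using nbhd that unfolding zero_nbhd_def by (meson image_mono subset_trans)
  ultimately have "vN_bounded s (weak_topology T G) B"
    using B(1) unfolding vN_bounded_def by blast
  then show ?thesis
    using G(1) B(1) unfolding determines_boundedness_def by blast
qed

text \<open>The line through \<open>x\<close> is weakly bounded when all of \<open>G\<close>
  vanishes at \<open>x\<close>, hence bounded, and a Hausdorff space has no bounded line.\<close>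

lemma determines_boundedness_separates:
  assumes G: "determines_boundedness s T G" "G \<subseteq> dual s T" "G \<noteq> {}"
    and x: "x \<in> topspace T" "\<And>\<phi>. \<phi> \<in> G \<Longrightarrow> \<phi> x = 0"
  shows "x = 0"
proof (rule ccontr)
  assume "x \<noteq> 0"
  then obtain W where W: "zero_nbhd T W" "x \<notin> W"
    using zero_nbhd_separates[OF x(1)] by blast
  have "vN_bounded s T (range (\<lambda>c. s c x))"
  proof (rule pointwise_bounded_imp_bounded[OF G])
    show "range (\<lambda>c. s c x) \<subseteq> topspace T"
      using x(1) topspace_closed(3) by blast
    show "\<exists>r. \<forall>b\<in>range (\<lambda>c. s c x). norm (\<phi> b) \<le> r" if "\<phi> \<in> G" for \<phi>
      using x that dualD(2)[of \<phi> x] G(2) by (intro exI[of _ 0]) auto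
  qed
  then obtain r where r: "r > 0" "range (\<lambda>c. s c x) \<subseteq> s (of_real r) ` W"
    using W(1) unfolding vN_bounded_def by blast
  then obtain w where "w \<in> W" "s (of_real r) x = s (of_real r) w"
    by blast
  then show False
    using r(1) W(2) by simp
qed

end

section \<open>Extension of weakly defined functions\<close>

lemma topspace_kappa_dual: "topspace (kappa_dual s T) = dual s T"
  (is "_ = ?L")
proof
  show "topspace (kappa_dual s T) \<subseteq> ?L"
    using openin_topspace[of "kappa_dual s T"]
    unfolding kappa_dual_def openin_unif_conv_topology by blast
  have "zero_nbhd euclidean UNIV"
    by (simp add: zero_nbhd_openin)
  then have "openin (kappa_dual s T) ?L"
    unfolding kappa_dual_def openin_unif_conv_topology by blast
  then show "?L \<subseteq> topspace (kappa_dual s T)"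
    by (rule openin_subset)
qed

text \<open>The extension problem without operators and without \<open>U\<close>: \<open>g\<close>
  assigns to \<open>e'\<close> the function belonging to it, and \<open>separating\<close> is the
  form in which uniqueness on \<open>U\<close> enters.\<close>

locale weak_extension = F: lcHs sF F + E: lcHs sE E
  for sF :: "'k::real_or_complex \<Rightarrow> 'f::ab_group_add \<Rightarrow> 'f" and F
    and sE :: "'k \<Rightarrow> 'e::ab_group_add \<Rightarrow> 'e" and E +
  fixes G :: "('e \<Rightarrow> 'k) set" and g :: "('e \<Rightarrow> 'k) \<Rightarrow> 'f"
  assumes FS: "frechet sF F" "schwartz sF F"
    and E_complete: "locally_complete sE E"
    and G: "determines_boundedness sE E G" "G \<subseteq> dual sE E" "G \<noteq> {}"
    and g: "\<And>e'. e' \<in> G \<Longrightarrow> g e' \<in> topspace F"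
    and separating: "\<And>x. x \<in> topspace F \<Longrightarrow>
      (\<And>y. y \<in> dual sF F \<Longrightarrow> \<exists>e\<in>topspace E. \<forall>e'\<in>G. e' e = y (g e') \<Longrightarrow> y x = 0) \<Longrightarrow> x = 0"
begin

section \<open>Functionals represented by points of the target space\<close>

text \<open>The extension sought has \<open>e' (u y) = y (g e')\<close> on \<open>G\<close>, so
  \<open>e\<close> is a candidate for its value at \<open>y\<close>.\<close>

definition represents :: "('f \<Rightarrow> 'k) \<Rightarrow> 'e \<Rightarrow> bool" where
  "represents y e \<longleftrightarrow> y \<in> dual sF F \<and> e \<in> topspace E \<and> (\<forall>e'\<in>G. e' e = y (g e'))"

definition Y :: "('f \<Rightarrow> 'k) set" where
  "Y = {y. \<exists>e. represents y e}"

text \<open>The choice is unique by \<open>represents_unique\<close>; the value \<open>0\<close> off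
  \<open>Y\<close> fits the extension by zero built into \<open>cont_linear\<close>.\<close>

definition u :: "('f \<Rightarrow> 'k) \<Rightarrow> 'e" where
  "u y = (if y \<in> Y then SOME e. represents y e else 0)"

lemma Y_subset: "Y \<subseteq> dual sF F"
  unfolding Y_def represents_def by blast

lemma represents_unique:
  assumes "represents y e" "represents y e2"
  shows "e = e2"
proof -
  have "e - e2 = 0"
  proof (rule E.determines_boundedness_separates[OF G])
    show "\<phi> (e - e2) = 0" if \<phi>: "\<phi> \<in> G" for \<phi>
    proof -
      have "\<phi> e = y (g \<phi>)" "\<phi> e2 = y (g \<phi>)" "e \<in> topspace E" "e2 \<in> topspace E"
        using assms \<phi> unfolding represents_def by blast+
      then show ?thesis
        using E.dualD(6)[OF subsetD[OF G(2) \<phi>], of e e2] by simp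
    qed
  qed (use assms in \<open>auto simp: represents_def E.topspace_closed(4)\<close>)
  then show ?thesis
    by simp
qed

lemma represents_u: "y \<in> Y \<Longrightarrow> represents y (u y)"
  unfolding u_def by (auto simp: Y_def intro: someI)

lemma u_eqI: "represents y e \<Longrightarrow> u y = e"
  using represents_u represents_unique unfolding Y_def by blast

lemma represents_add: "represents y e \<Longrightarrow> represents y2 e2 \<Longrightarrow> represents (y + y2) (e + e2)"
  using G(2) E.dualD(1) unfolding represents_def
  by (auto simp: F.dual_add E.topspace_closed(2) subset_iff)

lemma represents_scale: "represents y e \<Longrightarrow> represents (fun_scale (*) c y) (sE c e)"
  using G(2) E.dualD(2) unfolding represents_def
  by (auto simp: F.dual_scale E.topspace_closed(3) subset_iff) (simp add: fun_scale_def)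

lemma represents_diff: "represents y e \<Longrightarrow> represents y2 e2 \<Longrightarrow> represents (y - y2) (e - e2)"
  using G(2) E.dualD(6) unfolding represents_def
  by (auto simp: F.dual_diff E.topspace_closed(4) subset_iff)

lemma represents_zero: "represents 0 0"
  using G(2) E.dualD(5) unfolding represents_def
  by (auto simp: F.dual_zero E.topspace_closed(1) subset_iff)

lemma Y_add: "y \<in> Y \<Longrightarrow> z \<in> Y \<Longrightarrow> y + z \<in> Y"
  and Y_scale: "y \<in> Y \<Longrightarrow> fun_scale (*) c y \<in> Y"
  and Y_diff: "y \<in> Y \<Longrightarrow> z \<in> Y \<Longrightarrow> y - z \<in> Y"
  and Y_zero: "0 \<in> Y"
  using represents_add represents_scale represents_diff represents_zero unfolding Y_def by blast+

lemma u_add: "y \<in> Y \<Longrightarrow> z \<in> Y \<Longrightarrow> u (y + z) = u y + u z"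
  and u_scale: "y \<in> Y \<Longrightarrow> u (fun_scale (*) c y) = sE c (u y)"
  and u_diff: "y \<in> Y \<Longrightarrow> z \<in> Y \<Longrightarrow> u (y - z) = u y - u z"
  by (auto intro!: u_eqI represents_add represents_scale represents_diff represents_u)

section \<open>Banach disks and the domain of the extension\<close>

text \<open>\<open>V\<close> absorbs \<open>g e'\<close> with factor \<open>r e'\<close>, so a bound
  \<open>c\<close> for \<open>y\<close> on \<open>V\<close> bounds
  \<open>e' (u y) = y (g e')\<close> by \<open>c * r e'\<close>. The disk \<open>D\<close> imposes
  the bounds \<open>r e'\<close>; it is bounded since \<open>G\<close> determines
  boundedness.\<close>

lemma bounding_disk:
  assumes V: "zero_nbhd F V"
  obtains D r where "closedin E D" "vN_bounded sE E D" "abs_convex sE D"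
    "\<And>y c. y \<in> Y \<Longrightarrow> c > 0 \<Longrightarrow> \<forall>x\<in>V. norm (y x) \<le> c \<Longrightarrow> u y \<in> sE (of_real c) ` D"
    "\<And>e' e. e' \<in> G \<Longrightarrow> e \<in> D \<Longrightarrow> norm (e' e) \<le> r e'"
    "\<And>e'. e' \<in> G \<Longrightarrow> r e' > 0 \<and> g e' \<in> sF (of_real (r e')) ` V"
proof -
  have "\<exists>r>0. g e' \<in> sF (of_real r) ` V" if "e' \<in> G" for e'
    by (rule F.zero_nbhd_absorbing[OF V g[OF that]]) blast
  then obtain r where r: "\<And>e'. e' \<in> G \<Longrightarrow> r e' > 0 \<and> g e' \<in> sF (of_real (r e')) ` V"
    by metis
  define D where "D = {e \<in> topspace E. \<forall>e'\<in>G. norm (e' e) \<le> r e'}"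
  show thesis
  proof
    have "closedin E {e \<in> topspace E. e' e \<in> cball 0 (r e')}" if "e' \<in> G" for e'
      using that G(2) E.dualD(3) by (intro closedin_continuous_map_preimage) auto
    then have "closedin E (\<Inter>e'\<in>G. {e \<in> topspace E. e' e \<in> cball 0 (r e')})"
      using G(3) by (intro closedin_INT) auto
    moreover have "(\<Inter>e'\<in>G. {e \<in> topspace E. e' e \<in> cball 0 (r e')}) = D"
      using G(3) unfolding D_def by auto
    ultimately show "closedin E D"
      by simp
    show "vN_bounded sE E D"
      by (rule E.pointwise_bounded_imp_bounded[OF G]) (auto simp: D_def)
    show "abs_convex sE D"
      unfolding abs_convex_def
    proof (intro ballI allI impI)
      fix x y and a b :: 'k
      assume x: "x \<in> D" and y: "y \<in> D" and ab: "norm a + norm b \<le> 1"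
      have T: "x \<in> topspace E" "y \<in> topspace E"
        using x y unfolding D_def by auto
      have "norm (e' (sE a x + sE b y)) \<le> r e'" if e': "e' \<in> G" for e'
      proof -
        have e'd: "e' \<in> dual sE E"
          using e' G(2) by blast
        have "e' (sE a x + sE b y) = a * e' x + b * e' y"
          using E.dualD(1,2)[OF e'd] T E.topspace_closed(3) by metis
        then have "norm (e' (sE a x + sE b y)) \<le> norm a * norm (e' x) + norm b * norm (e' y)"
          by (metis norm_triangle_ineq norm_mult)
        also have "\<dots> \<le> norm a * r e' + norm b * r e'"
          using x y e' unfolding D_def by (intro add_mono mult_left_mono) auto
        also have "\<dots> = (norm a + norm b) * r e'"
          by (simp add: distrib_right)
        also have "\<dots> \<le> 1 * r e'"
          using ab r[OF e'] by (intro mult_right_mono) auto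
        finally show ?thesis
          by simp
      qed
      then show "sE a x + sE b y \<in> D"
        unfolding D_def using T E.topspace_closed by auto
    qed
    show "u y \<in> sE (of_real c) ` D"
      if y: "y \<in> Y" and c: "c > 0" and le: "\<forall>x\<in>V. norm (y x) \<le> c" for y c
    proof -
      have uy: "u y \<in> topspace E" "\<And>e'. e' \<in> G \<Longrightarrow> e' (u y) = y (g e')" and yd: "y \<in> dual sF F"
        using represents_u[OF y] unfolding represents_def by auto
      have "norm (e' (sE (inverse (of_real c)) (u y))) \<le> r e'" if e': "e' \<in> G" for e'
      proof -
        obtain v where v: "v \<in> V" "g e' = sF (of_real (r e')) v"
          using r[OF e'] by blast
        have "v \<in> topspace F"
          using v V unfolding zero_nbhd_def by blast
        then have "y (g e') = of_real (r e') * y v"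
          unfolding v(2) by (rule F.dualD(2)[OF yd])
        moreover have "e' (sE (inverse (of_real c)) (u y)) = inverse (of_real c) * e' (u y)"
          using E.dualD(2) e' G(2) uy(1) by blast
        ultimately have "norm (e' (sE (inverse (of_real c)) (u y))) = inverse c * (r e' * norm (y v))"
          using uy(2)[OF e'] r[OF e'] c by (simp add: norm_mult norm_inverse)
        also have "\<dots> \<le> inverse c * (r e' * c)"
          using bspec[OF le v(1)] r[OF e'] c by (intro mult_left_mono) auto
        also have "\<dots> = r e'"
          using c by simp
        finally show ?thesis .
      qed
      then have "sE (inverse (of_real c)) (u y) \<in> D"
        unfolding D_def using uy(1) E.topspace_closed(3) by auto
      then show ?thesis
        using c by (subst E.in_scaled_iff) auto
    qed
  qed (use r in \<open>auto simp: D_def\<close>)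
qed

text \<open>A point \<open>y\<close> of the closure is approximated uniformly on \<open>V\<close> by
  a sequence \<open>z\<close> in \<open>Y\<close>. The images form a Cauchy sequence for the gauge
  of \<open>D\<close>, and their limit represents \<open>y\<close>.\<close>

lemma closed_Y_polar:
  assumes W: "zero_nbhd F W"
  shows "closed (Y \<inter> polar sF F W)"
proof -
  obtain V where V: "zero_nbhd F V" "abs_convex sF V" "V \<subseteq> W"
    and approx: "\<And>A y \<epsilon>. A \<subseteq> polar sF F W \<Longrightarrow> y \<in> closure A \<Longrightarrow> \<epsilon> > 0 \<Longrightarrow>
        \<exists>z\<in>A. \<forall>x\<in>V. norm (y x - z x) \<le> \<epsilon>"
    by (rule F.schwartz_polar_approximation[OF FS(2) W], rule that) assumption+
  obtain D r where D: "closedin E D" "vN_bounded sE E D" "abs_convex sE D"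
    and uD: "\<And>y c. y \<in> Y \<Longrightarrow> c > 0 \<Longrightarrow> \<forall>x\<in>V. norm (y x) \<le> c \<Longrightarrow> u y \<in> sE (of_real c) ` D"
    and r: "\<And>e' e. e' \<in> G \<Longrightarrow> e \<in> D \<Longrightarrow> norm (e' e) \<le> r e'"
      "\<And>e'. e' \<in> G \<Longrightarrow> r e' > 0 \<and> g e' \<in> sF (of_real (r e')) ` V"
    by (rule bounding_disk[OF V(1)], rule that) assumption+
  have DT: "D \<subseteq> topspace E"
    using D(1) by (rule closedin_subset)
  have banach: "banach_disk sE D"
    using E_complete D unfolding locally_complete_def by blast
  have "y \<in> Y \<inter> polar sF F W" if y: "y \<in> closure (Y \<inter> polar sF F W)" for y
  proof -
    have yW: "y \<in> polar sF F W"
      using closure_minimal[OF _ F.closed_polar[OF W], of "Y \<inter> polar sF F W"] y by blast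
    let ?\<epsilon> = "\<lambda>n. inverse (real (Suc n))"
    have "\<exists>z\<in>Y \<inter> polar sF F W. \<forall>x\<in>V. norm (y x - z x) \<le> ?\<epsilon> n" for n
      using y by (intro approx) auto
    then obtain z where z: "\<And>n. z n \<in> Y" "\<And>n. z n \<in> polar sF F W"
        "\<And>n x. x \<in> V \<Longrightarrow> norm (y x - z n x) \<le> ?\<epsilon> n"
      by (metis IntD1 IntD2)
    define \<sigma> where "\<sigma> n = u (z n)" for n
    \<comment> \<open>\<open>V\<close> lies in \<open>W\<close>, so \<open>z n\<close> is bounded by
      \<open>1\<close> on \<open>V\<close>.\<close>
    have \<sigma>D: "\<sigma> n \<in> sE (of_real 1) ` D" for n
      unfolding \<sigma>_def using z(1)
      by (rule uD) (use z(2)[of n] V(3) in \<open>auto simp: polar_def\<close>)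
    then have span: "\<sigma> n \<in> disk_span sE D" for n
      by (rule E.disk_spanI[OF D(3)]) simp
    have gauge: "gauge_of sE D (\<sigma> m - \<sigma> n) \<le> ?\<epsilon> m + ?\<epsilon> n" for m n
    proof (rule E.gauge_of_le)
      show pos: "?\<epsilon> m + ?\<epsilon> n > 0"
        by (simp add: add_pos_pos)
      have "\<forall>x\<in>V. norm ((z m - z n) x) \<le> ?\<epsilon> m + ?\<epsilon> n"
      proof
        fix x assume "x \<in> V"
        then show "norm ((z m - z n) x) \<le> ?\<epsilon> m + ?\<epsilon> n"
          using z(3)[of x m] z(3)[of x n] norm_triangle_ineq4[of "y x - z n x" "y x - z m x"]
          by simp
      qed
      then have "u (z m - z n) \<in> sE (of_real (?\<epsilon> m + ?\<epsilon> n)) ` D"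
        by (rule uD[OF Y_diff[OF z(1) z(1)] pos])
      then show "\<sigma> m - \<sigma> n \<in> sE (of_real (?\<epsilon> m + ?\<epsilon> n)) ` D"
        unfolding \<sigma>_def u_diff[OF z(1) z(1)] .
    qed
    have "\<exists>N. \<forall>m\<ge>N. \<forall>n\<ge>N. gauge_of sE D (\<sigma> m - \<sigma> n) < \<epsilon>" if "\<epsilon> > 0" for \<epsilon>
    proof -
      obtain N where N: "?\<epsilon> N < \<epsilon> / 2"
        using reals_Archimedean[of "\<epsilon> / 2"] \<open>\<epsilon> > 0\<close> by auto
      have "?\<epsilon> n < \<epsilon> / 2" if "n \<ge> N" for n
      proof -
        have "?\<epsilon> n \<le> ?\<epsilon> N"
          using that by (intro le_imp_inverse_le) auto
        then show ?thesis
          using N by linarith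
      qed
      note small = this
      have "gauge_of sE D (\<sigma> m - \<sigma> n) < \<epsilon>" if "m \<ge> N" "n \<ge> N" for m n
        using gauge[of m n] small[OF that(1)] small[OF that(2)] by linarith
      then show ?thesis
        by blast
    qed
    moreover have "range \<sigma> \<subseteq> disk_span sE D"
      using span by blast
    ultimately obtain l where l: "l \<in> disk_span sE D" "(\<lambda>n. gauge_of sE D (\<sigma> n - l)) \<longlonglongrightarrow> 0"
      using banach unfolding banach_disk_def by blast
    obtain a where a: "a > 0" "l \<in> sE (of_real a) ` D"
      using E.disk_span_real[OF l(1) D(3)] by blast
    have lT: "l \<in> topspace E"
      using a(2) DT E.topspace_closed(3) by blast
    have \<sigma>T: "\<sigma> n \<in> topspace E" for n
      using represents_u[OF z(1)[of n]] unfolding represents_def \<sigma>_def by blast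
    have span': "\<sigma> n - l \<in> disk_span sE D" for n
      using E.abs_convex_scaled_diff[OF D(3) \<sigma>D a(2)] a(1)
      by (intro E.disk_spanI[OF D(3), of _ "1 + a"]) auto
    \<comment> \<open>Two limits of \<open>e' (\<sigma> n)\<close>: gauge convergence gives
      \<open>e' l\<close>, while \<open>e' (\<sigma> n) = z n (g e')\<close> tends to
      \<open>y (g e')\<close> because \<open>g e'\<close> lies in a multiple of
      \<open>V\<close>.\<close>
    have "e' l = y (g e')" if e': "e' \<in> G" for e'
    proof (rule LIMSEQ_unique)
      have e'd: "e' \<in> dual sE E"
        using e' G(2) by blast
      show "(\<lambda>n. e' (\<sigma> n)) \<longlonglongrightarrow> e' l"
      proof (rule LIM_zero_cancel, rule Lim_null_comparison)
        show "\<forall>\<^sub>F n in sequentially. norm (e' (\<sigma> n) - e' l) \<le> r e' * gauge_of sE D (\<sigma> n - l)"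
          using E.norm_le_gauge_of[OF D(3) span' DT e'd r(1)[OF e']] r(2)[OF e']
            E.dualD(6)[OF e'd \<sigma>T lT]
          by (intro always_eventually) simp
        show "(\<lambda>n. r e' * gauge_of sE D (\<sigma> n - l)) \<longlonglongrightarrow> 0"
          using tendsto_mult_right_zero[OF l(2)] .
      qed
      obtain v where v: "v \<in> V" "g e' = sF (of_real (r e')) v"
        using r(2)[OF e'] by blast
      have vT: "v \<in> topspace F"
        using v V(1) unfolding zero_nbhd_def by blast
      show "(\<lambda>n. e' (\<sigma> n)) \<longlonglongrightarrow> y (g e')"
      proof (rule LIM_zero_cancel, rule Lim_null_comparison)
        have "norm (e' (\<sigma> n) - y (g e')) \<le> r e' * ?\<epsilon> n" for n
        proof -
          have "e' (\<sigma> n) = z n (g e')"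
            using represents_u[OF z(1)] e' unfolding represents_def \<sigma>_def by blast
          also have "\<dots> - y (g e') = - of_real (r e') * (y v - z n v)"
            using F.dualD(2)[of y v "of_real (r e')"] F.dualD(2)[of "z n" v "of_real (r e')"] yW z(2)[of n] vT
            unfolding v(2) polar_def by (simp add: algebra_simps)
          finally have "norm (e' (\<sigma> n) - y (g e')) = r e' * norm (y v - z n v)"
            using r(2)[OF e'] by (simp add: norm_mult)
          then show ?thesis
            using z(3)[OF v(1), of n] r(2)[OF e'] by (simp add: mult_left_mono)
        qed
        then show "\<forall>\<^sub>F n in sequentially. norm (e' (\<sigma> n) - y (g e')) \<le> r e' * ?\<epsilon> n"
          by (intro always_eventually) blast
        show "(\<lambda>n. r e' * ?\<epsilon> n) \<longlonglongrightarrow> 0"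
          using tendsto_mult_right_zero[OF LIMSEQ_inverse_real_of_nat] .
      qed
    qed
    then have "represents y l"
      using lT yW unfolding represents_def polar_def by blast
    then show ?thesis
      using yW unfolding Y_def by blast
  qed
  then show ?thesis
    using closure_subset closure_eq by (metis subsetI subset_antisym)
qed

text \<open>For \<open>y0\<close> outside \<open>Y\<close>, \<open>Banach_Dieudonne\<close> keeps
  \<open>y0\<close> away from \<open>Y\<close> on a compact disk. Separation then gives a point
  where \<open>Y\<close> vanishes and \<open>y0\<close> is \<open>1\<close>, but
  \<open>separating\<close> forces that point to be \<open>0\<close>.\<close>

lemma Y_eq_dual: "Y = dual sF F"
proof (rule ccontr)
  assume "Y \<noteq> dual sF F"
  then obtain y0 where y0: "y0 \<in> dual sF F" "y0 \<notin> Y"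
    using Y_subset by blast
  obtain W0 where W0: "zero_nbhd F W0" "y0 \<in> polar sF F W0"
    by (rule F.dual_bounded[OF y0(1)])
  \<comment> \<open>The translate \<open>y0 - Y\<close>; it misses \<open>0\<close> because
    \<open>y0\<close> is not in \<open>Y\<close>.\<close>
  define C where "C = {z \<in> dual sF F. y0 - z \<in> Y}"
  obtain K where K: "abs_convex sF K" "compactin F K" "\<forall>z\<in>C. \<exists>x\<in>K. norm (z x) > 1"
  proof (rule F.Banach_Dieudonne[OF FS, of C])
    show "C \<subseteq> dual sF F" "0 \<notin> C"
      using y0(2) unfolding C_def by auto
  next
    fix W assume W: "zero_nbhd F W"
    \<comment> \<open>\<open>y0\<close> and \<open>z\<close> are both bounded by \<open>1\<close> on
      \<open>W \<inter> W0\<close>, so their difference is bounded by \<open>1\<close> on half of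
      it. This presents the part of \<open>C\<close> in the polar of \<open>W\<close> as a preimage
      of \<open>Y \<inter> polar sF F W'\<close>.\<close>
    define W' where "W' = sF (of_real (1/2)) ` (W \<inter> W0)"
    have W': "zero_nbhd F W'"
      unfolding W'_def by (intro F.zero_nbhd_scaled zero_nbhd_Int W W0) simp
    have "y0 - z \<in> polar sF F W'" if z: "z \<in> polar sF F W" for z
    proof -
      have d: "y0 - z \<in> dual sF F"
        using z y0(1) F.dual_diff unfolding polar_def by blast
      have "norm ((y0 - z) x) \<le> 1" if x: "x \<in> W'" for x
      proof -
        obtain w where w: "w \<in> W" "w \<in> W0" "x = sF (of_real (1/2)) w"
          using x unfolding W'_def by blast
        have "w \<in> topspace F"
          using w W unfolding zero_nbhd_def by blast
        then have "(y0 - z) x = of_real (1/2) * (y0 - z) w"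
          unfolding w(3) by (rule F.dualD(2)[OF d])
        then have "norm ((y0 - z) x) = 1/2 * norm (y0 w - z w)"
          by (simp only: norm_mult norm_of_real) simp
        moreover have "norm (y0 w) \<le> 1" "norm (z w) \<le> 1"
          using w z W0(2) unfolding polar_def by auto
        ultimately show ?thesis
          using norm_triangle_ineq4[of "y0 w" "z w"] by linarith
      qed
      then show ?thesis
        using d unfolding polar_def by blast
    qed
    then have "C \<inter> polar sF F W = polar sF F W \<inter> (\<lambda>z. y0 - z) -` (Y \<inter> polar sF F W')"
      unfolding C_def polar_def by auto
    moreover have "continuous_on UNIV (\<lambda>z. y0 - z)"
      by (rule continuous_on_coordinatewise_then_product)
        (auto intro!: continuous_intros F.continuous_on_eval)
    ultimately show "closed (C \<inter> polar sF F W)"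
      by (simp only:) (intro closed_Int F.closed_polar[OF W] closed_vimage closed_Y_polar[OF W'])
  qed
  have "\<exists>x\<in>K. norm (y0 x - y x) > 1" if "y \<in> Y" for y
    using bspec[OF K(3), of "y0 - y"] that y0(1) Y_subset F.dual_diff unfolding C_def by auto
  then obtain x where x: "x \<in> topspace F" "y0 x = 1" "\<And>y. y \<in> Y \<Longrightarrow> y x = 0"
    using F.subspace_separation[OF K(1,2) Y_subset Y_zero Y_add Y_scale y0(1)] by blast
  have "x = 0"
    using x(1) by (rule separating) (use x(3) in \<open>auto simp: Y_def represents_def\<close>)
  then show False
    using x(2) F.dualD(5)[OF y0(1)] by simp
qed

section \<open>Continuity of the extension\<close>

text \<open>\<open>Banach_Dieudonne\<close> is applied to the functionals that \<open>u\<close> maps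
  outside an open \<open>N0\<close> inside \<open>N\<close>. This set misses \<open>0\<close>, and
  it is weak* closed on polars because approximation on \<open>V\<close> moves the values of
  \<open>u\<close> only by small multiples of a bounded disk.\<close>

lemma u_preimage_polar:
  assumes N: "zero_nbhd E N"
  obtains K where "abs_convex sF K" "compactin F K"
    "\<And>y. y \<in> dual sF F \<Longrightarrow> \<forall>x\<in>K. norm (y x) \<le> 1 \<Longrightarrow> u y \<in> N"
proof -
  obtain N0 where N0: "openin E N0" "0 \<in> N0" "N0 \<subseteq> N"
    using N unfolding zero_nbhd_def by blast
  define C where "C = {y \<in> dual sF F. u y \<notin> N0}"
  have uT: "u y \<in> topspace E" if "y \<in> dual sF F" for y
    using represents_u[of y] that Y_eq_dual unfolding represents_def by blast
  obtain K where K: "abs_convex sF K" "compactin F K" "\<forall>z\<in>C. \<exists>x\<in>K. norm (z x) > 1"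
  proof (rule F.Banach_Dieudonne[OF FS, of C])
    show "C \<subseteq> dual sF F" "0 \<notin> C"
      using N0(2) u_eqI[OF represents_zero] unfolding C_def by auto
  next
    fix W assume W: "zero_nbhd F W"
    obtain V where V: "zero_nbhd F V" "abs_convex sF V" "V \<subseteq> W"
      and approx: "\<And>A y \<epsilon>. A \<subseteq> polar sF F W \<Longrightarrow> y \<in> closure A \<Longrightarrow> \<epsilon> > 0 \<Longrightarrow>
          \<exists>z\<in>A. \<forall>x\<in>V. norm (y x - z x) \<le> \<epsilon>"
      by (rule F.schwartz_polar_approximation[OF FS(2) W], rule that) assumption+
    obtain D r where D: "closedin E D" "vN_bounded sE E D" "abs_convex sE D"
      and uD: "\<And>y c. y \<in> Y \<Longrightarrow> c > 0 \<Longrightarrow> \<forall>x\<in>V. norm (y x) \<le> c \<Longrightarrow> u y \<in> sE (of_real c) ` D"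
      and r: "\<And>e' e. e' \<in> G \<Longrightarrow> e \<in> D \<Longrightarrow> norm (e' e) \<le> r e'"
        "\<And>e'. e' \<in> G \<Longrightarrow> r e' > 0 \<and> g e' \<in> sF (of_real (r e')) ` V"
      by (rule bounding_disk[OF V(1)], rule that) assumption+
    have "y \<in> C \<inter> polar sF F W" if y: "y \<in> closure (C \<inter> polar sF F W)" for y
    proof -
      have yW: "y \<in> polar sF F W"
        using closure_minimal[OF _ F.closed_polar[OF W], of "C \<inter> polar sF F W"] y by blast
      then have yd: "y \<in> dual sF F"
        unfolding polar_def by blast
      have "u y \<notin> N0"
      proof
        assume "u y \<in> N0"
        obtain N1 where N1: "zero_nbhd E N1" "\<And>w. w \<in> N1 \<Longrightarrow> u y + w \<in> N0"
          by (rule E.openin_translate[OF N0(1) \<open>u y \<in> N0\<close>], rule that) assumption+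
        \<comment> \<open>\<open>N1\<close> absorbs \<open>D\<close> with factor \<open>t\<close>,
          so an error of \<open>inverse t\<close> on \<open>V\<close> moves the value of
          \<open>u\<close> by an element of \<open>N1\<close>.\<close>
        obtain t where t: "t > 0" "D \<subseteq> sE (of_real t) ` N1"
          using D(2) N1(1) unfolding vN_bounded_def by blast
        obtain z where z: "z \<in> C" "\<And>x. x \<in> V \<Longrightarrow> norm (y x - z x) \<le> inverse t"
          using approx[OF _ y, of "inverse t"] t(1) by auto
        have zd: "z \<in> dual sF F"
          using z(1) unfolding C_def by blast
        have "u (z - y) \<in> sE (of_real (inverse t)) ` D"
          using yd zd Y_eq_dual z(2) t(1) by (intro uD Y_diff) (auto simp: norm_minus_commute)
        then obtain w where "w \<in> N1" "u (z - y) = sE (of_real (inverse t)) (sE (of_real t) w)"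
          using t(2) by blast
        then have "u z - u y \<in> N1"
          using u_diff[of z y] yd zd Y_eq_dual t(1) by simp
        then have "u z \<in> N0"
          using N1(2)[of "u z - u y"] by simp
        then show False
          using z(1) unfolding C_def by blast
      qed
      then show ?thesis
        using yd yW unfolding C_def by blast
    qed
    then show "closed (C \<inter> polar sF F W)"
      using closure_subset closure_eq by (metis subsetI subset_antisym)
  qed
  show thesis
  proof (rule that[OF K(1,2)])
    fix y assume "y \<in> dual sF F" "\<forall>x\<in>K. norm (y x) \<le> 1"
    then have "y \<notin> C"
      using K(3) by force
    then show "u y \<in> N"
      using \<open>y \<in> dual sF F\<close> N0(3) unfolding C_def by blast
  qed
qed

text \<open>Continuity at \<open>0\<close> is \<open>u_preimage_polar\<close>; additivity translates
  it to every \<open>y\<close>.\<close>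

lemma u_continuous: "continuous_map (kappa_dual sF F) E u"
  unfolding continuous_map topspace_kappa_dual
proof (intro conjI allI impI)
  show "u ` dual sF F \<subseteq> topspace E"
    using represents_u Y_eq_dual unfolding represents_def by blast
  fix N assume N: "openin E N"
  show "openin (kappa_dual sF F) {y \<in> dual sF F. u y \<in> N}"
    unfolding kappa_dual_def openin_unif_conv_topology
  proof (intro conjI ballI)
    fix y assume "y \<in> {y \<in> dual sF F. u y \<in> N}"
    then have y: "y \<in> dual sF F" "u y \<in> N"
      by auto
    obtain N1 where N1: "zero_nbhd E N1" "\<And>w. w \<in> N1 \<Longrightarrow> u y + w \<in> N"
      by (rule E.openin_translate[OF N y(2)], rule that) assumption+
    obtain K where K: "abs_convex sF K" "compactin F K"
      "\<And>y. y \<in> dual sF F \<Longrightarrow> \<forall>x\<in>K. norm (y x) \<le> 1 \<Longrightarrow> u y \<in> N1"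
      by (rule u_preimage_polar[OF N1(1)], rule that) assumption+
    have ball: "zero_nbhd euclidean (ball 0 1 :: 'k set)"
      by (rule zero_nbhd_openin) auto
    have "{v \<in> dual sF F. \<forall>x\<in>\<Union>{K}. v x - y x \<in> ball 0 1} \<subseteq> {y \<in> dual sF F. u y \<in> N}"
    proof safe
      fix v assume v: "v \<in> dual sF F" "\<forall>x\<in>\<Union>{K}. v x - y x \<in> ball 0 1"
      have "u (v - y) \<in> N1"
        using v y(1) by (intro K(3) F.dual_diff) auto
      then show "u v \<in> N"
        using N1(2)[of "u v - u y"] u_diff[of v y] v(1) y(1) Y_eq_dual by simp
    qed
    then show "\<exists>\<B> V. finite \<B> \<and> \<B> \<subseteq> {K. abs_convex sF K \<and> compactin F K} \<and> zero_nbhd euclidean V \<and>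
        {v \<in> dual sF F. \<forall>x\<in>\<Union>\<B>. v x - y x \<in> V} \<subseteq> {y \<in> dual sF F. u y \<in> N}"
      using K(1,2) ball by (intro exI[of _ "{K}"] exI[of _ "ball 0 1"] conjI) auto
  qed blast
qed

theorem u_cont_linear: "u \<in> cont_linear (fun_scale (*)) (kappa_dual sF F) sE E"
  unfolding cont_linear_def linear_map_on_def topspace_kappa_dual
  using u_continuous u_add u_scale Y_eq_dual by (auto simp: u_def)

end

section \<open>Surjectivity of the restriction map\<close>

lemma topspace_eps_product:
  assumes "lcHs sE E"
  shows "topspace (eps_product sF F sE E) = cont_linear (fun_scale (*)) (kappa_dual sF F) sE E"
    (is "_ = ?L")
proof
  interpret lcHs sE E
    by (rule assms)
  show "topspace (eps_product sF F sE E) \<subseteq> ?L"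
    using openin_topspace[of "eps_product sF F sE E"]
    unfolding eps_product_def openin_unif_conv_topology by blast
  have "openin (eps_product sF F sE E) ?L"
    unfolding eps_product_def openin_unif_conv_topology using zero_nbhd_topspace by blast
  then show "?L \<subseteq> topspace (eps_product sF F sE E)"
    by (rule openin_subset)
qed

theorem theorem5p2p20:
  fixes sE :: "'k::real_or_complex \<Rightarrow> 'e::ab_group_add \<Rightarrow> 'e"
    and E :: "'e topology"
    and G :: "('e \<Rightarrow> 'k) set"
    and F :: "('w \<Rightarrow> 'k) topology"
    and FE :: "('w \<Rightarrow> 'e) topology"
    and M :: "'m set"
    and \<omega> :: "'m \<Rightarrow> 'i set"
    and domK :: "'m \<Rightarrow> ('w \<Rightarrow> 'k) set"
    and TK :: "'m \<Rightarrow> ('w \<Rightarrow> 'k) \<Rightarrow> 'i \<Rightarrow> 'k"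
    and domE :: "'m \<Rightarrow> ('w \<Rightarrow> 'e) set"
    and TE :: "'m \<Rightarrow> ('w \<Rightarrow> 'e) \<Rightarrow> 'i \<Rightarrow> 'e"
    and U :: "('m \<times> 'i) set"
  assumes "lcHs sE E" and "locally_complete sE E"
    and "G \<subseteq> dual sE E" and "module.subspace (fun_scale (*)) G"
    and "determines_boundedness sE E G"
    and "lcHs (fun_scale (*)) F"
    and "lcHs (fun_scale sE) FE" and "topspace FE \<subseteq> {f. range f \<subseteq> topspace E}"
    and "\<forall>x. delta F x \<in> dual (fun_scale (*)) F"
    and "eps_into_compatible F sE E FE"
    and "\<forall>m\<in>M. \<omega> m \<noteq> {}"
    and "operator_family (*) euclidean F M \<omega> domK TK"
    and "operator_family sE E FE M \<omega> domE TE"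
    and "strong_family F sE E FE M \<omega> TE TK"
    and "consistent_family F sE E FE M \<omega> TE TK"
    and "frechet (fun_scale (*)) F" and "schwartz (fun_scale (*)) F"
    and "set_of_uniqueness F M \<omega> TK U"
  shows "restriction_map TE U `
           (eps_map F ` topspace (eps_product (fun_scale (*)) F sE E)) =
         restriction_space F E TK G U"
proof
  interpret F: lcHs "fun_scale (*)" F
    by fact
  interpret E: lcHs sE E
    by fact
  let ?L = "topspace (eps_product (fun_scale (*)) F sE E)"
  have U: "m \<in> M" "x \<in> \<omega> m" if "(m, x) \<in> U" for m x
    using assms(18) that unfolding set_of_uniqueness_def by auto
  have consistent: "eps_map F v \<in> topspace FE" "op_eval F TK m x \<in> dual (fun_scale (*)) F"
      "TE m (eps_map F v) x = v (op_eval F TK m x)" if "v \<in> ?L" "(m, x) \<in> U" for v m x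
    using assms(15) that U unfolding consistent_family_def by blast+
  show "restriction_map TE U ` (eps_map F ` ?L) \<subseteq> restriction_space F E TK G U"
  proof (safe, unfold restriction_space_def, safe)
    fix v m x assume v: "v \<in> ?L" and mx: "(m, x) \<in> U"
    have f: "eps_map F v \<in> topspace FE"
      using v mx by (rule consistent)
    have "TE m (eps_map F v) x \<in> topspace E"
      using assms(13) U[OF mx] f unfolding operator_family_def by blast
    then show "restriction_map TE U (eps_map F v) (m, x) \<in> topspace E"
      using mx unfolding restriction_map_def by simp
  next
    fix v p assume "v \<in> ?L" "p \<notin> U"
    then show "restriction_map TE U (eps_map F v) p = undefined"
      unfolding restriction_map_def by simp
  next
    fix v e' assume v: "v \<in> ?L" and e': "e' \<in> G"
    show "\<exists>g\<in>topspace F. \<forall>(m, x)\<in>U. TK m g x = (e' \<circ> restriction_map TE U (eps_map F v)) (m, x)"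
    \<comment> \<open>The membership facts are drawn from consistency and strength at a point of
      \<open>U\<close>. For empty \<open>U\<close> the condition is vacuous and \<open>0\<close> is
      a witness.\<close>
    proof (cases "U = {}")
      case False
      then obtain m0 x0 where "(m0, x0) \<in> U"
        by auto
      then have f: "eps_map F v \<in> topspace FE"
        by (rule consistent(1)[OF v])
      have strong: "e' \<circ> eps_map F v \<in> topspace F"
          "TK m (e' \<circ> eps_map F v) x = e' (TE m (eps_map F v) x)" if "(m, x) \<in> U" for m x
        using assms(14) e' assms(3) f U[OF that] unfolding strong_family_def by blast+
      show ?thesis
        using strong(1)[OF \<open>(m0, x0) \<in> U\<close>] strong(2)
        by (intro bexI[of _ "e' \<circ> eps_map F v"]) (auto simp: restriction_map_def)
    qed (use F.topspace_closed(1) in auto)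
  qed
  show "restriction_space F E TK G U \<subseteq> restriction_map TE U ` (eps_map F ` ?L)"
  proof
    fix f assume "f \<in> restriction_space F E TK G U"
    then have f: "f \<in> U \<rightarrow>\<^sub>E topspace E"
        and ex: "\<And>e'. e' \<in> G \<Longrightarrow> \<exists>g\<in>topspace F. \<forall>(m, x)\<in>U. TK m g x = (e' \<circ> f) (m, x)"
      unfolding restriction_space_def by auto
    from ex have "\<forall>e'. \<exists>g. e' \<in> G \<longrightarrow> g \<in> topspace F \<and> (\<forall>(m, x)\<in>U. TK m g x = (e' \<circ> f) (m, x))"
      by blast
    then obtain g where g: "\<And>e'. e' \<in> G \<Longrightarrow> g e' \<in> topspace F"
        "\<And>e' m x. e' \<in> G \<Longrightarrow> (m, x) \<in> U \<Longrightarrow> TK m (g e') x = e' (f (m, x))"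
      by (fastforce dest: choice)
    have op_dual: "op_eval F TK m x \<in> dual (fun_scale (*)) F" if "(m, x) \<in> U" for m x
      using assms(18) that unfolding set_of_uniqueness_def by blast
    have op: "f (m, x) \<in> topspace E" "\<And>e'. e' \<in> G \<Longrightarrow> e' (f (m, x)) = op_eval F TK m x (g e')"
      if "(m, x) \<in> U" for m x
      using f that g unfolding op_eval_def zero_ext_def by auto
    \<comment> \<open>A subspace contains \<open>0\<close>. Nonemptiness gives the weak topology of
      \<open>G\<close> its full carrier.\<close>
    have "G \<noteq> {}"
    proof -
      have "vector_space (fun_scale (*) :: 'k \<Rightarrow> ('e \<Rightarrow> 'k) \<Rightarrow> 'e \<Rightarrow> 'k)"
        by unfold_locales (auto simp: fun_scale_def fun_eq_iff algebra_simps)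
      then show ?thesis
        using assms(4) module.subspace_0[of "fun_scale (*)" G] module_iff_vector_space by blast
    qed
    interpret weak_extension "fun_scale (*)" F sE E G g
    proof (unfold_locales, goal_cases)
      \<comment> \<open>The assumption \<open>separating\<close>: evaluations at points of
        \<open>U\<close> are represented by values of \<open>f\<close>, so they annihilate
        \<open>x\<close>, and uniqueness on \<open>U\<close> gives \<open>x = 0\<close>.\<close>
      case (8 x)
      have "TK m x i = 0" if "(m, i) \<in> U" for m i
        using 8(2)[OF op_dual[OF that]] op[OF that] 8(1) unfolding op_eval_def zero_ext_def by auto
      then show ?case
        using assms(18) 8(1) unfolding set_of_uniqueness_def by blast
    qed (fact assms \<open>G \<noteq> {}\<close> g(1))+
    have uL: "u \<in> ?L"
      unfolding topspace_eps_product[OF assms(1)] by (rule u_cont_linear)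
    have "f = restriction_map TE U (eps_map F u)"
    proof
      fix p :: "'m \<times> 'i"
      show "f p = restriction_map TE U (eps_map F u) p"
      proof (cases "p \<in> U")
        case True
        obtain m x where p: "p = (m, x)"
          by force
        have mx: "(m, x) \<in> U"
          using True p by simp
        \<comment> \<open>Representing elements are unique, so \<open>u\<close> takes the value
          \<open>f (m, x)\<close> at this functional; consistency identifies it with the operator
          applied to \<open>eps_map F u\<close>.\<close>
        have "represents (op_eval F TK m x) (f (m, x))"
          unfolding represents_def using op_dual[OF mx] op[OF mx] by blast
        then have "f (m, x) = TE m (eps_map F u) x"
          unfolding consistent(3)[OF uL mx] by (rule u_eqI[symmetric])
        then show ?thesis
          using mx p unfolding restriction_map_def by simp
      next
        case False
        then show ?thesis
          using PiE_arb[OF f] unfolding restriction_map_def by simp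
      qed
    qed
    then show "f \<in> restriction_map TE U ` (eps_map F ` ?L)"
      using uL by blast
  qed
qed

end
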